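(* Let $\rho>0$ and let $G$ be a locally integrable completely monotonic relaxation modulus with $G_\infty:=\lim_{t\to\infty}G(t)>0$. Let $Q(p)=p\,\tilde G(p)$ and $\kappa(p)=\rho^{1/2}p/Q(p)^{1/2}$. Then $\kappa$ is a complete Bernstein function, and there exist a number $B\ge 0$ and a positive Radon measure $\nu$ on $(0,\infty)$ with $\int_{(0,\infty)}\frac{\nu(dr)}{1+r}<\infty$ such that $$\kappa(p)=B\,p+\beta(p),\qquad \beta(p):=p\int_{(0,\infty)}\frac{\nu(dr)}{p+r},$$ for all $p\in\mathbb{C}\setminus(-\infty,0]$. Moreover, the attenuation function $\mathcal A(\omega):=\operatorname{Re}\beta(-i\omega)$ and the dispersion function $\mathcal D(\omega):=-\operatorname{Im}\beta(-i\omega)$ are expressed through the single measure $\nu$ by $$\mathcal A(\omega)=\operatorname{Re}\kappa(-i\omega)=\omega^2\int_{(0,\infty)}\frac{\nu(dr)}{\omega^2+r^2},\qquad \mathcal D(\omega)=\omega\int_{(0,\infty)}\frac{r\,\nu(dr)}{\omega^2+r^2}$$ for all real $\omega\neq0$.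
   Context: A function $f$ on $(0,\infty)$ is completely monotonic (CM) if it is infinitely differentiable and $(-1)^n f^{(n)}(x)\ge 0$ for all $x>0$, $n=0,1,2,\dots$. A CM function is locally integrable if it is integrable over $[0,1]$. By Bernstein's theorem, a locally integrable CM function has the form $G(t)=\int_{[0,\infty)}e^{-rt}\mu(dr)$, $t>0$, with a unique positive Radon measure $\mu$ on $[0,\infty)$, and $\int_{(0,\infty)}\mu(dr)/(1+r)<\infty$. $\tilde f(p)=\int_0^\infty f(t)e^{-pt}dt$ is the Laplace transform. Thus $Q(p)=p\int_{[0,\infty)}\mu(dr)/(p+r)$, which is taken on $\mathbb{C}\setminus(-\infty,0]$; $\kappa$ is the holomorphic function on $\mathbb{C}\setminus(-\infty,0]$ defined with the branch of the square root for which $Q(p)^{1/2}>0$ for $p>0$. A Bernstein function is a function $g\ge0$ on $[0,\infty)$ whose derivative is CM (such functions have a finite limit at $0$). A function $f:(0,\infty)\to\mathbb{R}$ is a complete Bernstein function if there is a Bernstein function $g$ with $f(x)=x^2\tilde g(x)$ for $x>0$; the term is also applied to the analytic continuation of $f$ to $\mathbb{C}\setminus(-\infty,0]$. *)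

theory Defs
  imports "HOL-Analysis.Analysis"
begin

definition slit_plane :: "complex set" where
  "slit_plane = - \<real>\<^sub>\<le>\<^sub>0"

text \<open>
  A function on the open half-line is a total function on the reals of which only the values
  at positive arguments matter.
\<close>

definition completely_monotonic :: "(real \<Rightarrow> real) \<Rightarrow> bool" where
  "completely_monotonic f \<longleftrightarrow>
     (\<forall>n. \<forall>x>0. (deriv ^^ n) f differentiable (at x) \<and> 0 \<le> (-1) ^ n * (deriv ^^ n) f x)"

definition locally_integrable_cm :: "(real \<Rightarrow> real) \<Rightarrow> bool" where
  "locally_integrable_cm f \<longleftrightarrow> completely_monotonic f \<and> set_integrable lborel {0..1} f"

definition laplace :: "(real \<Rightarrow> real) \<Rightarrow> complex \<Rightarrow> complex" where
  "laplace f p = (LINT t:{0<..}|lborel. complex_of_real (f t) * exp (- p * complex_of_real t))"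

definition bernstein_function :: "(real \<Rightarrow> real) \<Rightarrow> bool" where
  "bernstein_function g \<longleftrightarrow>
     (\<forall>t\<ge>0. 0 \<le> g t) \<and> (\<forall>t>0. g differentiable (at t)) \<and> completely_monotonic (deriv g)"

definition complete_bernstein :: "(real \<Rightarrow> real) \<Rightarrow> bool" where
  "complete_bernstein f \<longleftrightarrow>
     (\<exists>g. bernstein_function g \<and>
          (\<forall>x>0. complex_of_real (f x) = (complex_of_real x)\<^sup>2 * laplace g (complex_of_real x)))"

text \<open>The same notion for the analytic continuation to the slit plane.\<close>

definition complete_bernstein_slit :: "(complex \<Rightarrow> complex) \<Rightarrow> bool" where
  "complete_bernstein_slit F \<longleftrightarrow>
     F holomorphic_on slit_plane \<and>
     (\<exists>f. complete_bernstein f \<and> (\<forall>x>0. F (complex_of_real x) = complex_of_real (f x)))"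

text \<open>
  A Radon measure on an interval \<open>S\<close> is encoded as a Borel measure on the whole line that does
  not charge the complement of \<open>S\<close> and is finite on the compact subsets of \<open>S\<close>; on such an
  \<open>S\<close> inner regularity is automatic.
\<close>

definition radon_on :: "real set \<Rightarrow> real measure \<Rightarrow> bool" where
  "radon_on S \<mu> \<longleftrightarrow>
     sets \<mu> = sets borel \<and> emeasure \<mu> (- S) = 0 \<and>
     (\<forall>K. compact K \<and> K \<subseteq> S \<longrightarrow> emeasure \<mu> K < \<infinity>)"

text \<open>
  The measure of Bernstein's theorem. It is unique, so the choice operator picks out the measure
  of the representation whenever \<open>G\<close> is completely monotonic.
\<close>

definition represents :: "real measure \<Rightarrow> (real \<Rightarrow> real) \<Rightarrow> bool" where
  "represents \<mu> G \<longleftrightarrow>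
     radon_on {0..} \<mu> \<and>
     (\<forall>t>0. set_integrable \<mu> {0..} (\<lambda>r. exp (- r * t)) \<and> G t = (LINT r:{0..}|\<mu>. exp (- r * t)))"

definition bernstein_measure :: "(real \<Rightarrow> real) \<Rightarrow> real measure" where
  "bernstein_measure G = (SOME \<mu>. represents \<mu> G)"

text \<open>
  The function \<open>Q\<close> on the whole slit plane, where the Laplace integral of \<open>G\<close> converges only in
  the right half-plane.
\<close>

definition Q_mod :: "(real \<Rightarrow> real) \<Rightarrow> complex \<Rightarrow> complex" where
  "Q_mod G p = p * (LINT r:{0..}|bernstein_measure G. 1 / (p + complex_of_real r))"

text \<open>
  The holomorphic square root on the slit plane that is positive on the positive half-line; it is
  determined there by these conditions.
\<close>

definition is_sqrt_branch :: "(complex \<Rightarrow> complex) \<Rightarrow> (complex \<Rightarrow> complex) \<Rightarrow> bool" where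
  "is_sqrt_branch F S \<longleftrightarrow>
     S holomorphic_on slit_plane \<and> (\<forall>p\<in>slit_plane. (S p)\<^sup>2 = F p) \<and>
     (\<forall>x>0. S (complex_of_real x) \<in> \<real> \<and> 0 < Re (S (complex_of_real x)))"

definition sqrt_branch :: "(complex \<Rightarrow> complex) \<Rightarrow> complex \<Rightarrow> complex" where
  "sqrt_branch F = (SOME S. is_sqrt_branch F S)"

definition kappa :: "real \<Rightarrow> (real \<Rightarrow> real) \<Rightarrow> complex \<Rightarrow> complex" where
  "kappa \<rho> G p = complex_of_real (sqrt \<rho>) * p / sqrt_branch (Q_mod G) p"

definition beta_fun :: "real measure \<Rightarrow> complex \<Rightarrow> complex" where
  "beta_fun \<nu> p = p * (LINT r:{0<..}|\<nu>. 1 / (p + complex_of_real r))"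

definition attenuation :: "real measure \<Rightarrow> real \<Rightarrow> real" where
  "attenuation \<nu> \<omega> = Re (beta_fun \<nu> (- \<i> * complex_of_real \<omega>))"

definition dispersion :: "real measure \<Rightarrow> real \<Rightarrow> real" where
  "dispersion \<nu> \<omega> = - Im (beta_fun \<nu> (- \<i> * complex_of_real \<omega>))"

end

theory Submission
  imports Defs "HOL-Probability.Probability" "HOL-Complex_Analysis.Complex_Analysis"
begin

text \<open>
  Bernstein's theorem (after Feller): for a completely monotonic \<open>G\<close> the Taylor series at \<open>a\<close>
  gives \<open>G (a (1 - exp (- l / a)))\<close> as the Laplace transform at \<open>l\<close> of a measure on the multiples
  of \<open>1 / a\<close>; a weak limit for \<open>a \<rightarrow> \<infinity>\<close> represents \<open>G\<close>.

  The function \<open>Q\<close> maps the upper half-plane into its closure and avoids the negative half-line, so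
  \<open>S = sqrt \<rho> / Q powr (1/2)\<close> has nonpositive imaginary part there. The substitution
  \<open>p = ((1 + w) / (1 - w))\<^sup>2\<close> turns \<open>- S\<close> into a typically real function on the unit disc, that is, one
  with \<open>Im F \<ge> 0\<close> on the upper half-disc and real Taylor coefficients. The positive measures
  \<open>Im F (r cis t) sin t dt\<close> on \<open>{0..pi}\<close> have mass proportional to \<open>r F' 0\<close>, and a weak limit for
  \<open>r \<rightarrow> 1\<close> represents \<open>F\<close> by the kernel \<open>w / (1 - 2 w cos t + w\<^sup>2)\<close> (Rogosinski). In terms of \<open>p\<close> this is
  \<open>(p - 1) / (4 (p u + 1 - u))\<close> with \<open>u = (1 - cos t) / 2\<close>, a Stieltjes kernel with pole at \<open>- (1 - u) / u\<close>.
  Nonnegativity of \<open>S\<close> on the positive half-line makes \<open>1 / u\<close> integrable, and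
  \<open>Q x \<ge> G (1 / x)\<close>, which stays away from \<open>0\<close>, excludes a pole at \<open>0\<close>.
\<close>

section \<open>Bernstein's theorem\<close>

text \<open>Two objects of the statement come from a choice operator:
  \<open>bernstein_measure\<close> says something about \<open>G\<close> only once a representing
  measure exists, and \<open>sqrt_branch\<close> is identified with the principal root of
  \<open>Q\<close> through connectedness of the slit plane. Both compactness arguments extract weak
  limits of probability measures, so masses are first scaled to 1. Feller's measures are tilted by
  \<open>exp (- r)\<close> and divided by a value of \<open>G\<close> near \<open>G 1\<close>, which
  the limit has to undo; on the circles the mass is divided out, so a vanishing derivative at 0 is a
  case of its own. The sign of the imaginary part alone allows poles on the whole of the cut and at
  infinity. A pole at infinity would drive \<open>S x\<close> linearly to minus infinity, one at 0
  would make it blow up like \<open>1 / x\<close>; the two bounds on \<open>S\<close> remove exactly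
  these ends. As kappa is \<open>p * S p\<close>, the constant part of \<open>S\<close> becomes
  \<open>B\<close> and its measure becomes \<open>\<nu>\<close>. The Bernstein function that
  witnesses completeness is \<open>B\<close> plus the integral of
  \<open>(1 - exp (- r * t)) / r\<close>, whose derivative is the Laplace transform of
  \<open>\<nu>\<close>.\<close>

lemma completely_monotonic_DERIV:
  assumes "completely_monotonic G" "0 < x"
  shows "((deriv ^^ n) G has_real_derivative (deriv ^^ Suc n) G x) (at x)"
  using assms unfolding completely_monotonic_def
  by (simp add: DERIV_deriv_iff_real_differentiable)

lemma completely_monotonic_nonneg:
  assumes "completely_monotonic G" "0 < x"
  shows "0 \<le> (-1) ^ n * (deriv ^^ n) G x"
  using assms unfolding completely_monotonic_def by blast

lemma completely_monotonic_isCont: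
  assumes "completely_monotonic G" "0 < x"
  shows "isCont G x"
  using completely_monotonic_DERIV[OF assms, of 0] by (simp add: DERIV_isCont)

lemma completely_monotonic_antimono:
  assumes "completely_monotonic G" "0 < x" "x \<le> y"
  shows "G y \<le> G x"
proof (rule DERIV_nonpos_imp_nonincreasing[OF assms(3)])
  fix z assume "x \<le> z" "z \<le> y"
  then have "0 < z" using assms by simp
  then show "\<exists>d. (G has_real_derivative d) (at z) \<and> d \<le> 0"
    using completely_monotonic_DERIV[OF assms(1), of z 0]
      completely_monotonic_nonneg[OF assms(1), of z 1] by auto
qed

text \<open>All derivatives of \<open>G (a - z)\<close> in \<open>z\<close> are nonnegative, so the
  Lagrange remainders are nonnegative and the Taylor sums at 0 stay below the value at
  \<open>y\<close>. For the opposite bound the function is compared with its own dilation by a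
  factor \<open>c < 1\<close>, which leaves an error of order \<open>c ^ n\<close>.\<close>

lemma completely_monotonic_taylor_sums:
  assumes G: "completely_monotonic G" and a: "0 < a" and y: "0 < y" "y < a"
  shows "(\<lambda>n. (-1) ^ n * (deriv ^^ n) G a / fact n * y ^ n) sums G (a - y)"
proof -
  define h where "h n z = (-1) ^ n * (deriv ^^ n) G (a - z)" for n z
  have D: "(h n has_real_derivative h (Suc n) z) (at z)" if "z < a" for n z
  proof -
    have "((deriv ^^ n) G has_real_derivative (deriv ^^ Suc n) G (a - z)) (at (a - z))"
      using that by (intro completely_monotonic_DERIV[OF G]) auto
    then have "((\<lambda>z. (deriv ^^ n) G (a - z)) has_real_derivative (deriv ^^ Suc n) G (a - z) * (-1)) (at z)"
      by (rule DERIV_chain2) (auto intro!: derivative_eq_intros)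
    from DERIV_cmult[OF this, of "(-1) ^ n"] show ?thesis
      unfolding h_def by (simp add: algebra_simps)
  qed
  have nonneg: "0 \<le> h n z" if "z < a" for n z
    using completely_monotonic_nonneg[OF G, of "a - z" n] that by (simp add: h_def)
  have mono: "h n z \<le> h n z'" if "z \<le> z'" "z' < a" for n z z'
  proof (rule DERIV_nonneg_imp_nondecreasing[OF that(1)])
    fix x assume "z \<le> x" "x \<le> z'"
    then show "\<exists>d. (h n has_real_derivative d) (at x) \<and> 0 \<le> d"
      using D nonneg that by (intro exI[of _ "h (Suc n) x"]) auto
  qed
  \<comment> \<open>Any point strictly between \<open>y\<close> and \<open>a\<close> would serve: it
    stays in the domain of \<open>h\<close>, and the ratio \<open>c = y / y'\<close> is below
    1.\<close>
  define y' where "y' = (y + a) / 2"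
  define c where "c = y / y'"
  have y': "y < y'" "0 < y'" "y' < a" using y by (auto simp: y'_def)
  then have c: "0 < c" "c < 1" "c * y' = y" using y by (auto simp: c_def)
  define S where "S n = (\<Sum>k<n. h k 0 / fact k * y ^ k)" for n
  have upper: "S n \<le> h 0 y" for n
  proof -
    obtain t where t: "0 < t" "t \<le> y" "h 0 y = S n + h n t / fact n * y ^ n"
      using Maclaurin2[of y h "h 0" n] y D unfolding S_def by auto
    then show ?thesis using nonneg[of t n] y by (simp add: S_def)
  qed
  have lower: "h 0 y - c ^ n * h 0 y' \<le> S n" for n
  proof -
    txt \<open>Maclaurin's formula for \<open>c ^ n * h z - h (c * z)\<close>: all derivatives below the \<open>n\<close>-th
      are nonpositive at \<open>0\<close>, and the \<open>n\<close>-th one is nonnegative since \<open>c < 1\<close>.\<close>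
    define d where "d m z = c ^ n * h m z - c ^ m * h m (c * z)" for m z
    have cz: "c * z < a" if "z \<le> y'" "0 \<le> z" for z
      using mult_right_mono[of c 1 z] that c y' by auto
    have "(d m has_real_derivative d (Suc m) z) (at z)" if "0 \<le> z" "z \<le> y'" for m z
      unfolding d_def using that c y' cz[OF that(2,1)]
      by (auto intro!: derivative_eq_intros D DERIV_chain2[OF D])
    then obtain t where t: "0 < t" "t \<le> y'"
      "d 0 y' = (\<Sum>k<n. d k 0 / fact k * y' ^ k) + d n t / fact n * y' ^ n"
      using Maclaurin2[of y' d "d 0" n] y' by auto
    have "c * t \<le> t" using mult_right_mono[of c 1 t] t c by auto
    then have "0 \<le> d n t"
      using t c y' mono[of "c * t" t n] by (auto simp: d_def right_diff_distrib[symmetric])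
    then have "(\<Sum>k<n. d k 0 / fact k * y' ^ k) \<le> d 0 y'"
      using t y' by simp
    moreover have "- S n \<le> (\<Sum>k<n. d k 0 / fact k * y' ^ k)"
      unfolding S_def sum_negf[symmetric]
    proof (rule sum_mono)
      fix k
      have "- (h k 0 / fact k * y ^ k) = - (c ^ k * h k 0) / fact k * y' ^ k"
        by (simp add: c(3)[symmetric] power_mult_distrib)
      also have "\<dots> \<le> d k 0 / fact k * y' ^ k"
        using c y' nonneg[of 0 k] a
        by (intro mult_right_mono divide_right_mono) (auto simp: d_def)
      finally show "- (h k 0 / fact k * y ^ k) \<le> d k 0 / fact k * y' ^ k" .
    qed
    ultimately show ?thesis by (simp add: d_def c(3))
  qed
  have "(\<lambda>n. h 0 y - c ^ n * h 0 y') \<longlonglongrightarrow> h 0 y - 0 * h 0 y'"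
    using c by (intro tendsto_intros LIMSEQ_realpow_zero) auto
  then have "(\<lambda>n. h 0 y - c ^ n * h 0 y') \<longlonglongrightarrow> h 0 y"
    by simp
  then have "S \<longlonglongrightarrow> h 0 y"
    using upper lower by (rule_tac tendsto_sandwich[OF always_eventually always_eventually _ tendsto_const]) auto
  then show ?thesis unfolding sums_def S_def h_def by simp
qed

text \<open>The \<open>n\<close>-th Taylor term of \<open>G\<close> at \<open>a\<close>, taken at
  \<open>y = a * exp (- 1 / a)\<close> and divided by the sum of the series, sits at
  \<open>n / a\<close>. The value 1 of the Laplace variable is thus built into the weights, which
  makes the mass 1 and is the reason for the exponents \<open>l - 1\<close> below.\<close>

definition feller_measure :: "(real \<Rightarrow> real) \<Rightarrow> real \<Rightarrow> real measure" where
  "feller_measure G a = distr (density (count_space UNIV)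
      (\<lambda>n. ennreal ((-1) ^ n * (deriv ^^ n) G a / fact n * a ^ n * exp (- (real n / a))
                      / G (a - a * exp (- 1 / a))))) borel (\<lambda>n. real n / a)"

text \<open>At \<open>y = a * exp (- l / a)\<close> the power \<open>y ^ n\<close> is
  \<open>a ^ n\<close> times an exponential of the atom \<open>n / a\<close>, so the Taylor series
  becomes a Laplace transform. For \<open>l < 1\<close> the kernel grows; these values yield the
  exponential moments behind tightness.\<close>

lemma feller_measure_integral:
  assumes G: "completely_monotonic G" and pos: "\<And>x. 0 < x \<Longrightarrow> 0 < G x" and a: "0 < a" and l: "0 < l"
  shows "has_bochner_integral (feller_measure G a) (\<lambda>r. exp (- (l - 1) * r))
           (G (a - a * exp (- l / a)) / G (a - a * exp (- 1 / a)))"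
proof -
  define Z where "Z = G (a - a * exp (- 1 / a))"
  have Z: "0 < Z" unfolding Z_def using a by (intro pos) simp
  define w where "w n = (-1) ^ n * (deriv ^^ n) G a / fact n * a ^ n * exp (- (real n / a)) / Z" for n
  have w: "0 \<le> w n" for n
    using completely_monotonic_nonneg[OF G a, of n] a Z by (simp add: w_def)
  have "(\<lambda>n. (-1) ^ n * (deriv ^^ n) G a / fact n * (a * exp (- l / a)) ^ n) sums G (a - a * exp (- l / a))"
    using a l by (intro completely_monotonic_taylor_sums[OF G]) auto
  then have "(\<lambda>n. (-1) ^ n * (deriv ^^ n) G a / fact n * (a * exp (- l / a)) ^ n / Z)
      sums (G (a - a * exp (- l / a)) / Z)"
    by (rule sums_divide)
  also have "(\<lambda>n. (-1) ^ n * (deriv ^^ n) G a / fact n * (a * exp (- l / a)) ^ n / Z) =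
     (\<lambda>n. w n * exp (- (l - 1) * (real n / a)))"
  proof
    fix n
    have "exp (- l / a) ^ n = exp (- (real n / a)) * exp (- (l - 1) * (real n / a))"
      by (simp add: exp_add[symmetric] exp_of_nat_mult[symmetric] algebra_simps diff_divide_distrib add_divide_distrib)
    then show "(-1) ^ n * (deriv ^^ n) G a / fact n * (a * exp (- l / a)) ^ n / Z =
        w n * exp (- (l - 1) * (real n / a))"
      by (simp add: w_def power_mult_distrib)
  qed
  finally have s: "(\<lambda>n. w n * exp (- (l - 1) * (real n / a))) sums (G (a - a * exp (- l / a)) / Z)" .
  have i: "integrable (count_space UNIV) (\<lambda>n. w n * exp (- (l - 1) * (real n / a)))"
    unfolding integrable_count_space_nat_iff using s w by (simp add: sums_iff)
  then have "has_bochner_integral (count_space UNIV) (\<lambda>n. w n *\<^sub>R exp (- (l - 1) * (real n / a)))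
      (G (a - a * exp (- l / a)) / Z)"
    using s by (simp add: has_bochner_integral_iff integral_count_space_nat sums_iff)
  then have "has_bochner_integral (density (count_space UNIV) w) (\<lambda>n. exp (- (l - 1) * (real n / a)))
      (G (a - a * exp (- l / a)) / Z)"
    by (intro has_bochner_integral_density) (auto simp: w)
  then show ?thesis
    unfolding feller_measure_def Z_def[symmetric] w_def[symmetric]
    by (intro has_bochner_integral_distr) auto
qed

lemma real_distribution_feller_measure:
  assumes G: "completely_monotonic G" and pos: "\<And>x. 0 < x \<Longrightarrow> 0 < G x" and a: "0 < a"
  shows "real_distribution (feller_measure G a)"
proof -
  have "has_bochner_integral (feller_measure G a) (\<lambda>r. 1::real) 1"
    using feller_measure_integral[OF assms, of 1] pos[of "a - a * exp (- 1 / a)"] a by simp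
  then have "(\<integral>\<^sup>+r. ennreal 1 \<partial>feller_measure G a) = ennreal 1"
    unfolding has_bochner_integral_iff by (subst nn_integral_eq_integral) auto
  then have "prob_space (feller_measure G a)"
    by (intro prob_spaceI) simp
  then show ?thesis
    unfolding real_distribution_def real_distribution_axioms_def
    by (simp add: feller_measure_def)
qed

lemma AE_feller_measure: "0 < a \<Longrightarrow> AE r in feller_measure G a. 0 \<le> r"
  unfolding feller_measure_def by (subst AE_distr_iff) (auto simp: AE_density)

text \<open>Markov's inequality for \<open>exp (c * r)\<close>: the mass beyond \<open>R\<close> is
  at most \<open>C * exp (- c * R)\<close> for every member of the family.\<close>

lemma tight_markov:
  assumes M: "\<And>n. real_distribution (M n)" "\<And>n. AE r in M n. 0 \<le> r"
    and c: "0 < c"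
    and int: "\<And>n. integrable (M n) (\<lambda>r. exp (c * r))" "\<And>n. (\<integral>r. exp (c * r) \<partial>M n) \<le> (C::real)"
  shows "tight M"
  unfolding tight_def
proof (intro conjI allI impI M(1))
  fix \<epsilon> :: real assume \<epsilon>: "0 < \<epsilon>"
  have "((\<lambda>R. C * exp (- c * R)) \<longlongrightarrow> C * 0) at_top"
    using c by (intro tendsto_intros) (real_asymp)
  then have "\<forall>\<^sub>F R in at_top. C * exp (- c * R) < \<epsilon>"
    using \<epsilon> by (auto dest: order_tendstoD)
  then have "\<forall>\<^sub>F R in at_top. C * exp (- c * R) < \<epsilon> \<and> 0 < R"
    using eventually_gt_at_top eventually_conj by blast
  then obtain R where R: "C * exp (- c * R) < \<epsilon>" "0 < R"
    by (auto dest: eventually_happens)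
  \<comment> \<open>The intervals in \<open>tight\<close> are open on the left; the end -1 keeps a
    possible atom at 0 inside.\<close>
  have "1 - \<epsilon> < Sigma_Algebra.measure (M n) {-1<..R}" for n
  proof -
    interpret real_distribution "M n" by (rule M)
    have "1 - measure (M n) {-1<..R} = measure (M n) (- {-1<..R})"
      using prob_compl[of "{-1<..R}"] by (simp add: Compl_eq_Diff_UNIV)
    also have "\<dots> = (\<integral>r. indicator (- {-1<..R}) r \<partial>M n)"
      by simp
    also have "\<dots> \<le> (\<integral>r. exp (- c * R) * exp (c * r) \<partial>M n)"
    proof (rule integral_mono_AE)
      show "AE r in M n. indicator (- {-1<..R}) r \<le> exp (- c * R) * exp (c * r)"
        using M(2)[of n] c
        by (auto simp: indicator_def exp_add[symmetric] mult_left_mono elim!: eventually_mono)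
      show "integrable (M n) (indicat_real (- {-1<..R}))"
        by (intro integrable_const_bound[of _ 1]) auto
    qed (use int in auto)
    also have "\<dots> \<le> exp (- c * R) * C"
      using int by simp
    finally show ?thesis using R by (simp add: mult.commute)
  qed
  then show "\<exists>a b. a < b \<and> (\<forall>n. 1 - \<epsilon> < Sigma_Algebra.measure (M n) {a<..b})"
    using R by (intro exI[of _ "-1"] exI[of _ R]) auto
qed

text \<open>The indicator of the negative half-line is not continuous. The bounded continuous
  \<open>f\<close>, which vanishes exactly on the nonnegative half-line, replaces it, and its zero
  integrals pass to the limit.\<close>

lemma weak_limit_AE_nonneg:
  assumes M: "\<And>n. real_distribution (M n)" "\<And>n. AE r in M n. 0 \<le> r"
    and L: "real_distribution L" and lim: "weak_conv_m M L"
  shows "AE r in L. 0 \<le> r"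
proof -
  interpret L: real_distribution L by (rule L)
  define f where "f r = min 1 (max 0 (- r))" for r :: real
  have [measurable]: "f \<in> borel_measurable borel" unfolding f_def by measurable
  have bd: "norm (f r) \<le> 1" for r by (auto simp: f_def)
  have "(\<lambda>n. integral\<^sup>L (M n) f) \<longlonglongrightarrow> integral\<^sup>L L f"
  proof (rule weak_conv_imp_integral_bdd_continuous_conv[OF M(1) L lim _ bd])
    show "isCont f r" for r unfolding f_def[abs_def] by (intro continuous_intros)
  qed
  moreover have "integral\<^sup>L (M n) f = 0" for n
    using M(2)[of n] by (intro integral_eq_zero_AE) (auto simp: f_def elim!: eventually_mono)
  ultimately have "integral\<^sup>L L f = 0"
    by (simp add: LIMSEQ_const_iff)
  moreover have "integrable L f"
    using bd by (intro L.integrable_const_bound[of _ 1]) auto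
  ultimately have "AE r in L. f r = 0"
    using integral_nonneg_eq_0_iff_AE[of L f] by (simp add: f_def)
  then show ?thesis by eventually_elim (auto simp: f_def min_def max_def split: if_splits)
qed

text \<open>Convergence for the exponent \<open>l / 2\<close> makes the kernel with exponent \<open>l\<close> uniformly
  integrable, which is what unbounded kernels (\<open>l < 1\<close>) require.\<close>

lemma weak_limit_laplace:
  fixes F :: "real \<Rightarrow> real"
  assumes M: "\<And>n. real_distribution (M n)" "\<And>n. AE r in M n. 0 \<le> r"
    and L: "real_distribution L" and lim: "weak_conv_m M L"
    and int: "\<And>n l. 0 < l \<Longrightarrow> integrable (M n) (\<lambda>r. exp (- (l - 1) * r))"
    and conv: "\<And>l. 0 < l \<Longrightarrow> (\<lambda>n. \<integral>r. exp (- (l - 1) * r) \<partial>M n) \<longlonglongrightarrow> F l"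
    and l: "0 < l"
  shows "has_bochner_integral L (\<lambda>r. exp (- (l - 1) * r)) (F l)"
proof -
  interpret L: real_distribution L by (rule L)
  note L_nonneg = weak_limit_AE_nonneg[OF M L lim]
  define f where "f l r = exp (- (l - 1) * r)" for l r :: real
  \<comment> \<open>The kernel, cut off linearly between \<open>K\<close> and \<open>K + 1\<close>,
    with \<open>max 0 r\<close> bounding it on the negative half-line too. The result is bounded and
    continuous, as weak convergence requires.\<close>
  define g where "g K r = f l (max 0 r) * max 0 (min 1 (real K + 1 - r))" for K r
  have f_pos: "0 < f l r" for l r by (simp add: f_def)
  have f_meas [measurable]: "f l \<in> borel_measurable borel" for l
    unfolding f_def[abs_def] by measurable
  have g_meas [measurable]: "g K \<in> borel_measurable borel" for K
    unfolding g_def[abs_def] by measurable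
  obtain C where C: "\<And>n. (\<integral>r. f (l / 2) r \<partial>M n) \<le> C"
  proof -
    have "Bseq (\<lambda>n. \<integral>r. f (l / 2) r \<partial>M n)"
      using conv[of "l / 2"] l unfolding f_def by (intro convergent_imp_Bseq convergentI) auto
    then obtain C where "\<And>n. norm (\<integral>r. f (l / 2) r \<partial>M n) \<le> C" by (auto simp: Bseq_def)
    then show ?thesis using that[of C] by (auto simp: abs_le_iff)
  qed
  have g_cont: "isCont (g K) r" for K r
    unfolding g_def f_def by (intro continuous_intros)
  have g_nonneg: "0 \<le> g K r" for K r
    using f_pos by (simp add: g_def less_imp_le)
  have g_bd: "norm (g K r) \<le> exp (\<bar>l - 1\<bar> * (real K + 1))" for K r
  proof (cases "r \<le> real K + 1")
    case True
    have "- (l - 1) * max 0 r \<le> \<bar>l - 1\<bar> * (real K + 1)"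
      using True by (intro mult_mono) auto
    then have "f l (max 0 r) \<le> exp (\<bar>l - 1\<bar> * (real K + 1))" by (simp add: f_def)
    then have "f l (max 0 r) * max 0 (min 1 (real K + 1 - r)) \<le> exp (\<bar>l - 1\<bar> * (real K + 1)) * 1"
      by (intro mult_mono) auto
    then show ?thesis using g_nonneg[of K r] by (simp add: g_def)
  qed (simp add: g_def)
  have g_le: "g K r \<le> f l r" if "0 \<le> r" for K r
    using mult_left_mono[of "max 0 (min 1 (real K + 1 - r))" 1 "f l r"] that f_pos[of l r]
    by (simp add: g_def)
  \<comment> \<open>The error of the cut-off lives on \<open>r > K\<close>, where one half of the
    exponent \<open>l\<close> gives the small factor and the other half is integrated with the bound
    \<open>C\<close>, uniformly in \<open>n\<close>.\<close>
  have f_le: "f l r \<le> g K r + exp (- (l / 2) * real K) * f (l / 2) r" if "0 \<le> r" for K r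
  proof (cases "r \<le> real K")
    case True
    then show ?thesis using f_pos[of "l / 2" r] that by (simp add: g_def)
  next
    case False
    have "f l r = exp (- (l / 2) * r) * f (l / 2) r"
      by (simp add: f_def exp_add[symmetric] field_simps)
    also have "\<dots> \<le> exp (- (l / 2) * real K) * f (l / 2) r"
      using False l f_pos[of "l / 2" r] by (intro mult_right_mono) auto
    finally show ?thesis using g_nonneg[of K r] by simp
  qed
  have g_lim: "(\<lambda>n. \<integral>r. g K r \<partial>M n) \<longlonglongrightarrow> (\<integral>r. g K r \<partial>L)" for K
    by (rule weak_conv_imp_integral_bdd_continuous_conv[OF M(1) L lim g_cont g_bd])
  have g_intM: "integrable (M n) (g K)" for n K
  proof -
    interpret real_distribution "M n" by (rule M)
    show ?thesis using g_bd by (intro integrable_const_bound) auto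
  qed
  have g_intL: "integrable L (g K)" for K
    using g_bd by (intro L.integrable_const_bound) auto
  have upper: "(\<integral>r. g K r \<partial>L) \<le> F l" for K
  proof (rule LIMSEQ_le[OF g_lim conv[OF l]], intro exI allI impI)
    fix n
    show "(\<integral>r. g K r \<partial>M n) \<le> (\<integral>r. exp (- (l - 1) * r) \<partial>M n)"
      using M(2)[of n] g_le int[OF l] g_intM
      by (intro integral_mono_AE) (auto simp: f_def elim!: eventually_mono)
  qed
  have lower: "F l \<le> (\<integral>r. g K r \<partial>L) + exp (- (l / 2) * real K) * C" for K
  proof (rule LIMSEQ_le[OF conv[OF l] tendsto_add[OF g_lim tendsto_const]], intro exI allI impI)
    fix n
    have i: "integrable (M n) (\<lambda>r. exp (- (l / 2) * real K) * f (l / 2) r)"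
      using int[of "l / 2" n] l by (auto simp: f_def)
    have "(\<integral>r. exp (- (l - 1) * r) \<partial>M n) \<le> (\<integral>r. g K r + exp (- (l / 2) * real K) * f (l / 2) r \<partial>M n)"
      using M(2)[of n] f_le int[OF l] g_intM i
      by (intro integral_mono_AE Bochner_Integration.integrable_add)
         (auto simp: f_def elim!: eventually_mono)
    also have "\<dots> = (\<integral>r. g K r \<partial>M n) + exp (- (l / 2) * real K) * (\<integral>r. f (l / 2) r \<partial>M n)"
      using i g_intM by (subst Bochner_Integration.integral_add) auto
    also have "\<dots> \<le> (\<integral>r. g K r \<partial>M n) + exp (- (l / 2) * real K) * C"
      using C by simp
    finally show "(\<integral>r. exp (- (l - 1) * r) \<partial>M n) \<le> (\<integral>r. g K r \<partial>M n) + exp (- (l / 2) * real K) * C" .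
  qed
  have "(\<lambda>K. F l - exp (- (l / 2) * real K) * C) \<longlonglongrightarrow> F l - 0 * C"
    using l by (intro tendsto_intros) real_asymp
  then have g_conv: "(\<lambda>K. \<integral>r. g K r \<partial>L) \<longlonglongrightarrow> F l"
    using upper lower
    by (rule_tac tendsto_sandwich[OF always_eventually always_eventually _ tendsto_const])
       (auto simp: algebra_simps)
  have mono: "mono (\<lambda>K. g K r)" for r
    using f_pos[of l "max 0 r"] by (intro monoI) (auto simp: g_def intro!: mult_left_mono)
  have ptw: "(\<lambda>K. g K r) \<longlonglongrightarrow> f l r" if "0 \<le> r" for r
  proof -
    have "\<forall>\<^sub>F K in sequentially. r \<le> real K"
      using filterlim_real_sequentially by (auto simp: filterlim_at_top)
    then have "\<forall>\<^sub>F K in sequentially. g K r = f l r"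
      by eventually_elim (use that in \<open>auto simp: g_def\<close>)
    then show ?thesis by (rule tendsto_eventually)
  qed
  have "has_bochner_integral L (f l) (F l)"
  proof (rule has_bochner_integral_monotone_convergence[OF g_intL])
    show "AE r in L. mono (\<lambda>K. g K r)" using mono by simp
    show "AE r in L. (\<lambda>K. g K r) \<longlonglongrightarrow> f l r"
      using L_nonneg by eventually_elim (rule ptw)
  qed (use g_conv in auto)
  then show ?thesis by (simp add: f_def[abs_def])
qed

theorem bernstein_representation:
  assumes G: "completely_monotonic G" and pos: "\<And>x. 0 < x \<Longrightarrow> 0 < G x"
  obtains \<mu> where "represents \<mu> G"
proof -
  define M where "M n = feller_measure G (real (Suc n))" for n
  have M: "real_distribution (M n)" "AE r in M n. 0 \<le> r" for n
    unfolding M_def using real_distribution_feller_measure[OF G pos] AE_feller_measure by auto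
  have hbi: "has_bochner_integral (M n) (\<lambda>r. exp (- (l - 1) * r))
      (G (real (Suc n) - real (Suc n) * exp (- l / real (Suc n))) /
       G (real (Suc n) - real (Suc n) * exp (- 1 / real (Suc n))))" if "0 < l" for n l
    unfolding M_def using that by (intro feller_measure_integral[OF G pos]) auto
  then have int: "integrable (M n) (\<lambda>r. exp (- (l - 1) * r))" if "0 < l" for n l
    using that by (auto simp: has_bochner_integral_iff)
  \<comment> \<open>With \<open>a = n + 1\<close>, the argument \<open>a - a * exp (- l / a)\<close>
    tends to \<open>l\<close>.\<close>
  have conv0: "(\<lambda>n. G (real (Suc n) - real (Suc n) * exp (- l / real (Suc n)))) \<longlonglongrightarrow> G l"
    if "0 < l" for l
    by (rule isCont_tendsto_compose[OF completely_monotonic_isCont[OF G that]]) real_asymp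
  have conv: "(\<lambda>n. \<integral>r. exp (- (l - 1) * r) \<partial>M n) \<longlonglongrightarrow> G l / G 1" if "0 < l" for l
    using tendsto_divide[OF conv0[OF that] conv0[of 1]] pos[of 1] hbi[OF that]
    by (simp add: has_bochner_integral_iff)
  \<comment> \<open>At the Laplace variable 1/2 the tilted kernel is \<open>exp (r / 2)\<close>;
    convergence of its integrals bounds an exponential moment uniformly.\<close>
  have "Bseq (\<lambda>n. \<integral>r. exp (- (1/2 - 1) * r) \<partial>M n)"
    using conv[of "1/2"] by (intro convergent_imp_Bseq convergentI) auto
  then obtain C where "\<And>n. norm (\<integral>r. exp (- (1/2 - 1) * r) \<partial>M n) \<le> C" by (auto simp: Bseq_def)
  then have C: "(\<integral>r. exp (1/2 * r) \<partial>M n) \<le> C" for n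
    by (force simp: abs_le_iff)
  have "tight M"
    using int[of "1/2"] by (intro tight_markov[OF M _ _ C]) auto
  then obtain s L where s: "strict_mono (s :: nat \<Rightarrow> nat)" and L: "real_distribution L"
    and lim: "weak_conv_m (M \<circ> id \<circ> s) L"
    using tight_imp_convergent_subsubsequence[of M id] by (auto simp: strict_mono_def)
  interpret L: real_distribution L by (rule L)
  have Ms: "real_distribution ((M \<circ> id \<circ> s) n)" "AE r in (M \<circ> id \<circ> s) n. 0 \<le> r" for n
    unfolding o_def id_def by (rule M)+
  have lap: "has_bochner_integral L (\<lambda>r. exp (- (l - 1) * r)) (G l / G 1)" if "0 < l" for l
  proof (rule weak_limit_laplace[OF Ms L lim _ _ that])
    fix l :: real assume "0 < l"
    from LIMSEQ_subseq_LIMSEQ[OF conv[OF this] s]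
    show "(\<lambda>n. \<integral>r. exp (- (l - 1) * r) \<partial>(M \<circ> id \<circ> s) n) \<longlonglongrightarrow> G l / G 1" by (simp add: comp_def)
  qed (use int in auto)
  have nonneg: "AE r in L. 0 \<le> r"
    by (rule weak_limit_AE_nonneg[OF Ms L lim])
  \<comment> \<open>The factor \<open>exp r\<close> undoes the tilt and \<open>G 1\<close> undoes
    the limit of the normalizations, so the total mass may now be infinite.\<close>
  define \<mu> where "\<mu> = density L (\<lambda>r. ennreal (G 1 * exp r))"
  have sets[measurable_cong]: "sets \<mu> = sets borel" by (simp add: \<mu>_def)
  have int_\<mu>: "has_bochner_integral \<mu> (\<lambda>r. indicator {0..} r *\<^sub>R exp (- r * t)) (G t)" if "0 < t" for t
  proof -
    have "has_bochner_integral L (\<lambda>r. G 1 * exp (- (t - 1) * r)) (G t)"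
      using has_bochner_integral_mult_right[OF lap[OF that], of "G 1"] pos[of 1] by simp
    also have "?this \<longleftrightarrow> has_bochner_integral L (\<lambda>r. (G 1 * exp r) *\<^sub>R (indicator {0..} r *\<^sub>R exp (- r * t))) (G t)"
    proof (rule has_bochner_integral_cong_AE)
      show "AE r in L. G 1 * exp (- (t - 1) * r) = (G 1 * exp r) *\<^sub>R (indicator {0..} r *\<^sub>R exp (- r * t))"
        using nonneg by eventually_elim (simp add: exp_add[symmetric] algebra_simps)
    qed auto
    finally show ?thesis
      unfolding \<mu>_def using pos[of 1]
      by (intro has_bochner_integral_density) (auto intro: AE_I2 less_imp_le)
  qed
  have "radon_on {0..} \<mu>"
    unfolding radon_on_def
  proof (intro conjI allI impI sets)
    have "AE r in \<mu>. r \<notin> - {0..}"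
      unfolding \<mu>_def using nonneg by (subst AE_density) (auto elim!: eventually_mono)
    then show "emeasure \<mu> (- {0..}) = 0"
      by (subst (asm) AE_iff_measurable[OF _ refl]) (auto simp: \<mu>_def Compl_eq_Diff_UNIV Collect_neg_eq atLeast_def)
    fix K :: "real set" assume K: "compact K \<and> K \<subseteq> {0..}"
    then obtain R where R: "\<And>r. r \<in> K \<Longrightarrow> r \<le> R"
      by (meson bdd_above.E bounded_imp_bdd_above compact_imp_bounded)
    have [measurable]: "K \<in> sets borel" using K by (simp add: borel_compact)
    have "emeasure \<mu> K = (\<integral>\<^sup>+r. ennreal (G 1 * exp r) * indicator K r \<partial>L)"
      unfolding \<mu>_def by (subst emeasure_density) auto
    also have "\<dots> \<le> (\<integral>\<^sup>+r. ennreal (G 1 * exp R) \<partial>L)"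
      using R pos[of 1] by (intro nn_integral_mono) (auto simp: indicator_def intro!: ennreal_leI)
    also have "\<dots> < \<infinity>" by (simp add: L.emeasure_space_1[simplified])
    finally show "emeasure \<mu> K < \<infinity>" .
  qed
  then have "represents \<mu> G"
    using int_\<mu> unfolding represents_def set_integrable_def set_lebesgue_integral_def
    by (auto simp: has_bochner_integral_iff)
  then show ?thesis by (rule that)
qed

section \<open>Stieltjes transforms\<close>

lemma slit_plane_iff: "p \<in> slit_plane \<longleftrightarrow> \<not> (Im p = 0 \<and> Re p \<le> 0)"
  by (auto simp: slit_plane_def complex_nonpos_Reals_iff)

lemma open_slit_plane: "open slit_plane"
  unfolding slit_plane_def by (simp add: open_Compl)

lemma slit_plane_of_real: "0 < x \<Longrightarrow> complex_of_real x \<in> slit_plane"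
  by (simp add: slit_plane_iff)

lemma slit_plane_Re_pos: "0 < Re p \<Longrightarrow> p \<in> slit_plane"
  by (auto simp: slit_plane_iff)

lemma slit_plane_add_ne_0: "p \<in> slit_plane \<Longrightarrow> 0 \<le> r \<Longrightarrow> p + complex_of_real r \<noteq> 0"
  by (auto simp: slit_plane_iff complex_eq_iff)

text \<open>Locally uniform domination of the Stieltjes kernel by a multiple of
  \<open>1 / (1 + r)\<close>: for bounded \<open>r\<close> the distance from the cut matters, for
  large \<open>r\<close> the growth of \<open>r\<close>.\<close>

lemma slit_plane_norm_lower:
  assumes p: "p \<in> slit_plane"
  obtains c e where "0 < c" "0 < e"
    "\<And>q r. dist q p < e \<Longrightarrow> 0 \<le> r \<Longrightarrow> q \<in> slit_plane \<and> c * (1 + r) \<le> norm (q + complex_of_real r)"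
proof -
  from open_slit_plane p obtain d where d: "0 < d" "ball p d \<subseteq> slit_plane"
    by (auto simp: open_contains_ball)
  define e where "e = d / 2"
  \<comment> \<open>The constant results from combining \<open>e \<le> norm (q + r)\<close> with
    \<open>r \<le> norm (q + r) + norm p + e\<close>.\<close>
  define c where "c = e / (1 + norm p + 2 * e)"
  have e: "0 < e" using d by (simp add: e_def)
  have den: "0 < 1 + norm p + 2 * e" using e by (simp add: add_pos_nonneg)
  show ?thesis
  proof (rule that[of c e])
    fix q r assume q: "dist q p < e" and r: "(0::real) \<le> r"
    have "- complex_of_real r \<notin> slit_plane" using r by (simp add: slit_plane_iff)
    then have "2 * e \<le> dist p (- complex_of_real r)" using d by (force simp: e_def)
    also have "\<dots> \<le> dist q p + dist q (- complex_of_real r)"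
      by (metis dist_commute dist_triangle)
    finally have 1: "e \<le> norm (q + complex_of_real r)" using q by (simp add: dist_norm)
    have "r \<le> norm (q + complex_of_real r) + norm q"
      using norm_triangle_ineq4[of "q + complex_of_real r" q] r by simp
    moreover have "norm q \<le> norm p + e"
      using q norm_triangle_sub[of q p] by (simp add: dist_norm)
    ultimately have 2: "r \<le> norm (q + complex_of_real r) + norm p + e" by simp
    have "e * (1 + r) \<le> e * norm (q + complex_of_real r) + e * (1 + norm p + e)"
      using mult_left_mono[OF 2, of e] e by (simp add: algebra_simps)
    also have "\<dots> \<le> e * norm (q + complex_of_real r) + norm (q + complex_of_real r) * (1 + norm p + e)"
      using 1 e by (intro add_left_mono mult_right_mono) auto
    also have "\<dots> = norm (q + complex_of_real r) * (1 + norm p + 2 * e)"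
      by (simp add: algebra_simps)
    finally have "c * (1 + r) \<le> norm (q + complex_of_real r)"
      using den by (simp add: c_def field_simps)
    moreover have "q \<in> slit_plane" using q d by (auto simp: e_def dist_commute subset_eq)
    ultimately show "q \<in> slit_plane \<and> c * (1 + r) \<le> norm (q + complex_of_real r)" by simp
  qed (use e den in \<open>simp_all add: c_def\<close>)
qed

lemma inverse_bound:
  fixes z :: complex and c r :: real
  assumes "0 < c" "0 \<le> r" "c * (1 + r) \<le> norm z"
  shows "norm (1 / z) \<le> (1 / c) * (1 / (1 + r))" "norm (1 / z) \<le> 1 / c"
proof -
  have p: "0 < c * (1 + r)" using assms by simp
  have "norm (1 / z) \<le> 1 / (c * (1 + r))"
    unfolding norm_divide norm_one using p assms(3) by (intro frac_le) auto
  then show 1: "norm (1 / z) \<le> (1 / c) * (1 / (1 + r))" by simp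
  have "(1 / c) * (1 / (1 + r)) \<le> (1 / c) * 1"
    using assms by (intro mult_left_mono) auto
  with 1 show "norm (1 / z) \<le> 1 / c" by simp
qed

lemma set_integral_bound:
  fixes f :: "real \<Rightarrow> 'a :: {banach, second_countable_topology}" and g :: "real \<Rightarrow> real"
  assumes [measurable_cong]: "sets \<mu> = sets borel" and A[measurable]: "A \<in> sets borel"
    and g: "set_integrable \<mu> A g"
    and f: "f \<in> borel_measurable borel" "\<And>r. r \<in> A \<Longrightarrow> norm (f r) \<le> C * g r"
  shows "set_integrable \<mu> A f" "norm (LINT r:A|\<mu>. f r) \<le> C * (LINT r:A|\<mu>. g r)"
proof -
  note f(1)[measurable]
  have i: "integrable \<mu> (\<lambda>r. C * (indicator A r *\<^sub>R g r))"
    using g unfolding set_integrable_def by (rule integrable_mult_right)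
  have b: "norm (indicator A r *\<^sub>R f r) \<le> C * (indicator A r *\<^sub>R g r)" for r
    using f(2)[of r] by (cases "r \<in> A") auto
  show int: "set_integrable \<mu> A f"
    unfolding set_integrable_def
  proof (rule Bochner_Integration.integrable_bound[OF i])
    show "AE r in \<mu>. norm (indicator A r *\<^sub>R f r) \<le> norm (C * (indicator A r *\<^sub>R g r))"
      using order_trans[OF b] by (intro AE_I2) (simp add: real_norm_def)
  qed simp
  have "norm (LINT r:A|\<mu>. f r) \<le> (\<integral>r. C * (indicator A r *\<^sub>R g r) \<partial>\<mu>)"
    unfolding set_lebesgue_integral_def
    using int i b unfolding set_integrable_def
    by (intro order_trans[OF integral_norm_bound] integral_mono integrable_norm) auto
  then show "norm (LINT r:A|\<mu>. f r) \<le> C * (LINT r:A|\<mu>. g r)"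
    by (simp add: set_lebesgue_integral_def)
qed

lemma stieltjes_kernel_integrable:
  assumes sets: "sets \<mu> = sets borel" and A: "A \<in> sets borel" "A \<subseteq> {0..}"
    and int: "set_integrable \<mu> A (\<lambda>r. 1 / (1 + r))"
    and p: "p \<in> slit_plane"
  shows "set_integrable \<mu> A (\<lambda>r. 1 / (p + complex_of_real r))"
proof -
  obtain c e where c: "0 < c" "0 < e" "\<And>q r. dist q p < e \<Longrightarrow> 0 \<le> r \<Longrightarrow>
      q \<in> slit_plane \<and> c * (1 + r) \<le> norm (q + complex_of_real r)"
    by (rule slit_plane_norm_lower[OF p]) blast
  show ?thesis
  proof (rule set_integral_bound(1)[OF sets A(1) int])
    fix r assume "r \<in> A"
    then show "norm (1 / (p + complex_of_real r)) \<le> (1 / c) * (1 / (1 + r))"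
      using A c(2) c(3)[of p r] by (intro inverse_bound(1)[OF c(1)]) auto
  qed measurable
qed

text \<open>The difference quotient minus the formal derivative is \<open>q - p\<close> times the
  integral of \<open>1 / ((q + r) * (p + r)\<^sup>2)\<close>, and that integral is bounded uniformly
  for \<open>q\<close> near \<open>p\<close>.\<close>

lemma stieltjes_holomorphic:
  assumes sets: "sets \<mu> = sets borel" and A: "A \<in> sets borel" "A \<subseteq> {0..}"
    and int: "set_integrable \<mu> A (\<lambda>r. 1 / (1 + r))"
  shows "(\<lambda>p. LINT r:A|\<mu>. 1 / (p + complex_of_real r)) holomorphic_on slit_plane"
proof (rule holomorphic_onI)
  fix p assume p: "p \<in> slit_plane"
  define f where "f q = (LINT r:A|\<mu>. 1 / (q + complex_of_real r))" for q
  note K = stieltjes_kernel_integrable[OF sets A int]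
  obtain c e where c: "0 < c" "0 < e" "\<And>q r. dist q p < e \<Longrightarrow> 0 \<le> r \<Longrightarrow>
      q \<in> slit_plane \<and> c * (1 + r) \<le> norm (q + complex_of_real r)"
    by (rule slit_plane_norm_lower[OF p]) blast
  have r0: "0 \<le> r" if "r \<in> A" for r using that A by auto
  have inv: "norm (1 / (q + complex_of_real r)) \<le> (1 / c) * (1 / (1 + r))"
    "norm (1 / (q + complex_of_real r)) \<le> 1 / c" if "dist q p < e" "r \<in> A" for q r
    using inverse_bound[OF c(1) r0[OF that(2)]] c(3)[OF that(1) r0[OF that(2)]] by auto
  have i2: "set_integrable \<mu> A (\<lambda>r. 1 / (p + complex_of_real r) ^ 2)"
  proof (rule set_integral_bound(1)[OF sets A(1) int])
    fix r assume "r \<in> A"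
    then have "norm (1 / (p + complex_of_real r)) * norm (1 / (p + complex_of_real r)) \<le> (1 / c) * ((1 / c) * (1 / (1 + r)))"
      using c(1,2) inv[of p r] r0[of r] by (intro mult_mono) auto
    then show "norm (1 / (p + complex_of_real r) ^ 2) \<le> ((1 / c) * (1 / c)) * (1 / (1 + r))"
      by (simp add: norm_mult norm_divide power2_eq_square)
  qed measurable
  define D where "D = (LINT r:A|\<mu>. - (1 / (p + complex_of_real r) ^ 2))"
  define I where "I = (LINT r:A|\<mu>. 1 / (1 + r))"
  have est: "norm ((f q - f p) / (q - p) - D) \<le> norm (q - p) * ((1 / c) ^ 3 * I)"
    if q: "dist q p < e" "q \<noteq> p" for q
  proof -
    have qs: "q \<in> slit_plane" using c(3)[OF q(1), of 0] by simp
    have "(f q - f p) / (q - p) - D =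
       (LINT r:A|\<mu>. (1 / (q + complex_of_real r) - 1 / (p + complex_of_real r)) / (q - p) + 1 / (p + complex_of_real r) ^ 2)"
      unfolding f_def D_def using K[OF qs] K[OF p] i2
      by (subst set_integral_add(2)) (auto simp: set_integral_diff set_integral_uminus)
    also have "\<dots> = (LINT r:A|\<mu>. (q - p) / ((q + complex_of_real r) * (p + complex_of_real r) ^ 2))"
    proof (rule set_lebesgue_integral_cong, use sets A in simp, safe)
      fix r assume "r \<in> A"
      then have nz: "q + complex_of_real r \<noteq> 0" "p + complex_of_real r \<noteq> 0"
        using slit_plane_add_ne_0[OF _ r0] p qs by auto
      have "(1 / x - 1 / y) / (x - y) + 1 / y ^ 2 = (x - y) / (x * y ^ 2)"
        if "x \<noteq> 0" "y \<noteq> 0" "x \<noteq> y" for x y :: complex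
        using that by (simp add: field_simps power2_eq_square)
      from this[OF nz] q(2)
      show "(1 / (q + complex_of_real r) - 1 / (p + complex_of_real r)) / (q - p) + 1 / (p + complex_of_real r) ^ 2 =
          (q - p) / ((q + complex_of_real r) * (p + complex_of_real r) ^ 2)"
        by simp
    qed
    also have "norm \<dots> \<le> (norm (q - p) * (1 / c) ^ 3) * I"
      unfolding I_def
    proof (rule set_integral_bound(2)[OF sets A(1) int])
      fix r assume "r \<in> A"
      \<comment> \<open>One of the three kernels carries the integrable \<open>1 / (1 + r)\<close>;
        the other two are bounded by \<open>1 / c\<close>.\<close>
      then have "norm (q - p) * (norm (1 / (q + complex_of_real r)) * (norm (1 / (p + complex_of_real r)) * norm (1 / (p + complex_of_real r))))
        \<le> norm (q - p) * ((1 / c) * ((1 / c) * ((1 / c) * (1 / (1 + r)))))"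
        using c(1,2) inv[of p r] inv[of q r] r0[of r] q(1) by (intro mult_mono) auto
      then show "norm ((q - p) / ((q + complex_of_real r) * (p + complex_of_real r) ^ 2)) \<le> norm (q - p) * (1 / c) ^ 3 * (1 / (1 + r))"
        by (simp add: norm_mult norm_divide power2_eq_square power3_eq_cube)
    qed measurable
    also have "\<dots> = norm (q - p) * ((1 / c) ^ 3 * I)"
      by (simp add: mult.assoc)
    finally show ?thesis .
  qed
  have "((\<lambda>q. (f q - f p) / (q - p)) \<longlongrightarrow> D) (at p)"
  proof (rule Lim_null[THEN iffD2], rule Lim_null_comparison)
    show "\<forall>\<^sub>F q in at p. norm ((f q - f p) / (q - p) - D) \<le> norm (q - p) * ((1 / c) ^ 3 * I)"
      using c(2) est by (auto simp: eventually_at)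
    have "((\<lambda>q. norm (q - p) * ((1 / c) ^ 3 * I)) \<longlongrightarrow> norm (p - p) * ((1 / c) ^ 3 * I)) (at p)"
      by (intro tendsto_intros)
    then show "((\<lambda>q. norm (q - p) * ((1 / c) ^ 3 * I)) \<longlongrightarrow> 0) (at p)" by simp
  qed
  then have "(f has_field_derivative D) (at p)"
    by (simp add: has_field_derivative_iff)
  then show "(\<lambda>p. LINT r:A|\<mu>. 1 / (p + complex_of_real r)) field_differentiable at p within slit_plane"
    unfolding f_def[abs_def] field_differentiable_def by (blast intro: has_field_derivative_at_within)
qed

section \<open>Laplace transforms\<close>

lemma sigma_finite_borelI:
  fixes \<mu> :: "real measure"
  assumes "sets \<mu> = sets borel" "\<And>n::nat. emeasure \<mu> {..real n} < \<infinity>"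
  shows "sigma_finite_measure \<mu>"
proof
  have "(\<Union>n::nat. {..real n}) = (UNIV :: real set)"
    using real_arch_simple by auto
  then show "\<exists>A. countable A \<and> A \<subseteq> sets \<mu> \<and> \<Union>A = space \<mu> \<and> (\<forall>a\<in>A. emeasure \<mu> a \<noteq> \<infinity>)"
    using assms sets_eq_imp_space_eq[OF assms(1)]
    by (intro exI[of _ "range (\<lambda>n::nat. {..real n})"]) (auto simp: less_top)
qed

lemma sigma_finite_radon:
  assumes "radon_on {0..} \<mu>"
  shows "sigma_finite_measure \<mu>"
proof (rule sigma_finite_borelI)
  show sets: "sets \<mu> = sets borel" using assms by (simp add: radon_on_def)
  fix n :: nat
  have "emeasure \<mu> {..real n} \<le> emeasure \<mu> (- {0..} \<union> {0..real n})"
    using sets by (intro emeasure_mono) auto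
  also have "\<dots> \<le> emeasure \<mu> (- {0..}) + emeasure \<mu> {0..real n}"
    using sets by (intro emeasure_subadditive) auto
  also have "\<dots> < \<infinity>" using assms by (auto simp: radon_on_def)
  finally show "emeasure \<mu> {..real n} < \<infinity>" .
qed

text \<open>On this set \<open>1 / (1 + r)\<close> is at least
  \<open>1 / (1 + \<bar>R\<bar>)\<close>. Local finiteness and sigma-finiteness of the constructed
  measure follow from its integrability condition in this way.\<close>

lemma emeasure_bounded_part:
  fixes \<mu> :: "real measure" and R :: real
  assumes sets: "sets \<mu> = sets borel" and A: "A \<in> sets borel" "A \<subseteq> {0..}"
    and int: "set_integrable \<mu> A (\<lambda>r. 1 / (1 + r))"
  shows "emeasure \<mu> (A \<inter> {..R}) < \<infinity>"
proof -
  have "set_integrable \<mu> A (indicator {..R} :: real \<Rightarrow> real)"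
  proof (rule set_integral_bound(1)[OF sets A(1) int])
    fix r assume "r \<in> A"
    then have "0 \<le> r" using A by auto
    then show "norm (indicator {..R} r :: real) \<le> (1 + \<bar>R\<bar>) * (1 / (1 + r))"
      by (auto simp: indicator_def field_simps)
  qed simp
  then have "integrable \<mu> (indicator (A \<inter> {..R}) :: real \<Rightarrow> real)"
    by (simp add: set_integrable_def indicator_inter_arith[abs_def])
  then show ?thesis
    using sets_eq_imp_space_eq[OF sets] by (simp add: integrable_indicator_iff)
qed

lemma stieltjes_kernel_integrable_real:
  assumes sets: "sets \<mu> = sets borel" and A: "A \<in> sets borel" "A \<subseteq> {0..}"
    and int: "set_integrable \<mu> A (\<lambda>r. 1 / (1 + r))"
    and x: "(0::real) < x"
  shows "set_integrable \<mu> A (\<lambda>r. 1 / (x + r))"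
proof (rule set_integral_bound(1)[OF sets A(1) int])
  fix r assume "r \<in> A"
  then have r: "0 \<le> r" using A by auto
  have "min 1 x * (1 + r) \<le> x + r"
    using mult_right_mono[of "min 1 x" 1 r] r by (simp add: distrib_left)
  moreover have "0 < min 1 x * (1 + r)" using x r by (intro mult_pos_pos) auto
  ultimately have "1 / (x + r) \<le> 1 / (min 1 x * (1 + r))"
    by (intro frac_le) auto
  then show "norm (1 / (x + r)) \<le> (1 / min 1 x) * (1 / (1 + r))"
    using x r by simp
qed measurable

lemma exp_laplace:
  fixes z :: complex
  assumes z: "0 < Re z"
  shows "set_integrable lborel {0<..} (\<lambda>t. exp (- z * complex_of_real t))"
    and "(LINT t:{0<..}|lborel. exp (- z * complex_of_real t)) = 1 / z"
    and "(LINT t:{0<..}|lborel. exp (- Re z * t)) = 1 / Re z"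
    and "set_integrable lborel {0<..} (\<lambda>t. exp (- Re z * t))"
proof -
  have e: "einterval 0 \<infinity> = {0<..}" by (auto simp: einterval_def)
  have i: "set_integrable lborel {0<..} (\<lambda>t. exp (- Re z * t))"
    using integrable_I0i_exp_mscale[OF z] by (simp add: interval_lebesgue_integrable_def e mult.commute)
  then show "set_integrable lborel {0<..} (\<lambda>t. exp (- Re z * t))" .
  show "(LINT t:{0<..}|lborel. exp (- Re z * t)) = 1 / Re z"
    using LBINT_I0i_exp_mscale[OF z] by (simp add: interval_lebesgue_integral_def e mult.commute)
  show c: "set_integrable lborel {0<..} (\<lambda>t. exp (- z * complex_of_real t))"
    by (rule set_integral_bound(1)[OF _ _ i, of _ 1]) auto
  have "(LBINT t=0..\<infinity>. exp (- z * complex_of_real t)) = 0 - (- 1 / z)"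
  proof (rule interval_integral_FTC_integrable[where F="\<lambda>t. - exp (- z * complex_of_real t) / z"])
    fix t :: real
    show "((\<lambda>t. - exp (- z * complex_of_real t) / z) has_vector_derivative exp (- z * complex_of_real t)) (at t)"
      using z by (auto intro!: derivative_eq_intros has_vector_derivative_real_field)
    show "isCont (\<lambda>t. exp (- z * complex_of_real t)) t"
      by (intro continuous_intros)
  next
    show "set_integrable lborel (einterval 0 \<infinity>) (\<lambda>t. exp (- z * complex_of_real t))"
      using c by (simp add: e)
  next
    have "((\<lambda>t. - exp (- z * complex_of_real t) / z) \<longlongrightarrow> - exp (- z * complex_of_real 0) / z) (at_right 0)"
      using z by (intro tendsto_intros) auto
    then show "(((\<lambda>t. - exp (- z * complex_of_real t) / z) \<circ> real_of_ereal) \<longlongrightarrow> - 1 / z) (at_right 0)"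
      by (simp add: zero_ereal_def ereal_tendsto_simps)
    have "((\<lambda>t. exp (- Re z * t)) \<longlongrightarrow> 0) at_top"
      using z by real_asymp
    then have "((\<lambda>t. exp (- z * complex_of_real t)) \<longlongrightarrow> 0) at_top"
      by (rule_tac tendsto_norm_zero_cancel) simp
    then have "((\<lambda>t. - exp (- z * complex_of_real t) / z) \<longlongrightarrow> - 0 / z) at_top"
      using z by (intro tendsto_intros) auto
    then show "(((\<lambda>t. - exp (- z * complex_of_real t) / z) \<circ> real_of_ereal) \<longlongrightarrow> 0) (at_left \<infinity>)"
      by (simp add: ereal_tendsto_simps)
  qed auto
  then show "(LINT t:{0<..}|lborel. exp (- z * complex_of_real t)) = 1 / z"
    by (simp add: interval_lebesgue_integral_def e)
qed

text \<open>Fubini for the kernel extended by zero. The function \<open>h\<close> is the inner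
  integral of the norm; in both uses it has a closed form, so absolute integrability becomes a
  condition on \<open>\<mu>\<close>.\<close>

lemma fubini_kernel:
  fixes K :: "real \<Rightarrow> real \<Rightarrow> complex"
  assumes \<mu>: "sigma_finite_measure \<mu>" and sets[measurable_cong]: "sets \<mu> = sets borel"
    and A[measurable]: "A \<in> sets borel"
    and K: "(\<lambda>(r, t). K r t) \<in> borel_measurable (borel \<Otimes>\<^sub>M borel)"
    and int: "\<And>r. r \<in> A \<Longrightarrow> set_integrable lborel {0<..} (K r)"
    and h: "\<And>r. r \<in> A \<Longrightarrow> (LINT t:{0<..}|lborel. norm (K r t)) = h r" "set_integrable \<mu> A h"
  shows "(LINT t:{0<..}|lborel. (LINT r:A|\<mu>. K r t)) = (LINT r:A|\<mu>. (LINT t:{0<..}|lborel. K r t))"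
    and "set_integrable lborel {0<..} (\<lambda>t. LINT r:A|\<mu>. K r t)"
proof -
  interpret sigma_finite_measure \<mu> by (rule \<mu>)
  interpret P: pair_sigma_finite \<mu> lborel ..
  define k where "k r t = indicator A r *\<^sub>R (indicator {0<..} t *\<^sub>R K r t)" for r t
  note K[measurable]
  have [measurable]: "case_prod k \<in> borel_measurable (\<mu> \<Otimes>\<^sub>M lborel)"
  proof -
    have "(\<lambda>x. indicator A (fst x) *\<^sub>R (indicator {0<..} (snd x) *\<^sub>R (case x of (r, t) \<Rightarrow> K r t)))
        \<in> borel_measurable (borel \<Otimes>\<^sub>M borel)" by measurable
    then show ?thesis
      unfolding k_def by (simp add: case_prod_beta' cong: measurable_cong_sets sets_pair_measure_cong)
  qed
  have k_int: "integrable (\<mu> \<Otimes>\<^sub>M lborel) (case_prod k)"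
  proof (rule P.Fubini_integrable)
    have "(\<lambda>r. LINT t|lborel. norm (case (r, t) of (r, t) \<Rightarrow> k r t)) = (\<lambda>r. indicator A r *\<^sub>R h r)"
    proof
      fix r
      show "(LINT t|lborel. norm (case (r, t) of (r, t) \<Rightarrow> k r t)) = indicator A r *\<^sub>R h r"
        using h(1)[of r] unfolding set_lebesgue_integral_def
        by (cases "r \<in> A") (auto simp: k_def)
    qed
    then show "integrable \<mu> (\<lambda>r. LINT t|lborel. norm (case (r, t) of (r, t) \<Rightarrow> k r t))"
      using h(2) by (simp add: set_integrable_def)
    show "AE r in \<mu>. integrable lborel (\<lambda>t. case (r, t) of (r, t) \<Rightarrow> k r t)"
    proof (rule AE_I2)
      fix r
      show "integrable lborel (\<lambda>t. case (r, t) of (r, t) \<Rightarrow> k r t)"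
        using int[of r] by (cases "r \<in> A") (auto simp: k_def set_integrable_def)
    qed
  qed measurable
  have inner: "(\<lambda>t. LINT r|\<mu>. k r t) = (\<lambda>t. indicator {0<..} t *\<^sub>R (LINT r:A|\<mu>. K r t))"
    by (rule ext) (auto simp: k_def set_lebesgue_integral_def indicator_def)
  show "set_integrable lborel {0<..} (\<lambda>t. LINT r:A|\<mu>. K r t)"
    unfolding set_integrable_def inner[symmetric] by (rule P.integrable_snd[OF k_int])
  from P.Fubini_integral[OF k_int]
  have "(LINT t|lborel. (LINT r|\<mu>. k r t)) = (LINT r|\<mu>. (LINT t|lborel. k r t))" .
  also note inner
  also have "(\<lambda>r. LINT t|lborel. k r t) = (\<lambda>r. indicator A r *\<^sub>R (LINT t:{0<..}|lborel. K r t))"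
  proof
    fix r
    show "(LINT t|lborel. k r t) = indicator A r *\<^sub>R (LINT t:{0<..}|lborel. K r t)"
      by (cases "r \<in> A") (auto simp: k_def set_lebesgue_integral_def)
  qed
  finally show "(LINT t:{0<..}|lborel. (LINT r:A|\<mu>. K r t)) = (LINT r:A|\<mu>. (LINT t:{0<..}|lborel. K r t))"
    by (simp add: set_lebesgue_integral_def)
qed

text \<open>Tonelli turns the integral of \<open>G\<close> over \<open>{0<..1}\<close> into a double
  integral. Keeping only \<open>t \<le> 1 / (1 + r)\<close>, where \<open>r * t \<le> 1\<close>,
  bounds the inner integral below by \<open>exp (- 1) / (1 + r)\<close>.\<close>

lemma represents_stieltjes_integrable:
  assumes rep: "represents \<mu> G" and G: "set_integrable lborel {0..1} G"
  shows "set_integrable \<mu> {0..} (\<lambda>r. 1 / (1 + r))"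
proof -
  have radon: "radon_on {0..} \<mu>" using rep by (simp add: represents_def)
  then have sets[measurable_cong]: "sets \<mu> = sets borel" by (simp add: radon_on_def)
  interpret sigma_finite_measure \<mu> by (rule sigma_finite_radon[OF radon])
  interpret P: pair_sigma_finite \<mu> lborel ..
  define k where "k r t = ennreal (indicator {0..} r * (indicator {0<..1} t * exp (- r * t)))" for r t :: real
  have [measurable]: "case_prod k \<in> borel_measurable (\<mu> \<Otimes>\<^sub>M lborel)"
    unfolding k_def by measurable
  have "(\<integral>\<^sup>+r. ennreal (exp (- 1)) * ennreal (indicator {0..} r * (1 / (1 + r))) \<partial>\<mu>) \<le> (\<integral>\<^sup>+r. (\<integral>\<^sup>+t. k r t \<partial>lborel) \<partial>\<mu>)"
  proof (rule nn_integral_mono)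
    fix r
    show "ennreal (exp (- 1)) * ennreal (indicator {0..} r * (1 / (1 + r))) \<le> (\<integral>\<^sup>+t. k r t \<partial>lborel)"
    proof (cases "0 \<le> r")
      case True
      have "ennreal (exp (- 1)) * ennreal (indicator {0..} r * (1 / (1 + r))) =
          (\<integral>\<^sup>+t. ennreal (exp (- 1)) * indicator {0<..1 / (1 + r)} t \<partial>lborel)"
        using True by (simp add: nn_integral_cmult)
      also have "\<dots> \<le> (\<integral>\<^sup>+t. k r t \<partial>lborel)"
      proof (rule nn_integral_mono)
        fix t
        show "ennreal (exp (- 1)) * indicator {0<..1 / (1 + r)} t \<le> k r t"
        proof (cases "t \<in> {0<..1 / (1 + r)}")
          case t: True
          then have "t * (1 + r) \<le> 1" using True by (simp add: field_simps)
          moreover have "0 \<le> t * r" using t True by simp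
          ultimately have "t \<le> 1" "r * t \<le> 1" using t by (auto simp: algebra_simps)
          then show ?thesis using t True by (simp add: k_def)
        qed simp
      qed
      finally show ?thesis .
    qed simp
  qed
  also have "\<dots> = (\<integral>\<^sup>+t. (\<integral>\<^sup>+r. k r t \<partial>\<mu>) \<partial>lborel)"
    by (rule P.Fubini'[symmetric]) measurable
  also have "\<dots> = (\<integral>\<^sup>+t. ennreal (indicator {0<..1} t * G t) \<partial>lborel)"
  proof (rule nn_integral_cong)
    fix t
    show "(\<integral>\<^sup>+r. k r t \<partial>\<mu>) = ennreal (indicator {0<..1} t * G t)"
    proof (cases "t \<in> {0<..1}")
      case True
      then have "integrable \<mu> (\<lambda>r. indicator {0..} r * exp (- r * t))" "G t = (\<integral>r. indicator {0..} r * exp (- r * t) \<partial>\<mu>)"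
        using rep unfolding represents_def set_integrable_def set_lebesgue_integral_def by auto
      then show ?thesis using True by (simp add: k_def nn_integral_eq_integral)
    qed (simp add: k_def)
  qed
  also have "\<dots> < \<infinity>"
  proof -
    have "set_integrable lborel {0<..1} G"
      by (rule set_integrable_subset[OF G]) auto
    then have "integrable lborel (\<lambda>t. indicator {0<..1} t * G t)" by (simp add: set_integrable_def)
    then show ?thesis
      by (simp add: integrable_iff_bounded) (meson ennreal_leI abs_ge_self le_less_trans nn_integral_mono)
  qed
  finally have "(\<integral>\<^sup>+r. ennreal (indicator {0..} r * (1 / (1 + r))) \<partial>\<mu>) < \<infinity>"
    by (simp add: nn_integral_cmult ennreal_mult_less_top less_top[symmetric] ennreal_mult_eq_top_iff)
  then show ?thesis
    unfolding set_integrable_def by (intro integrableI_nonneg) (auto simp: indicator_def)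
qed

text \<open>Fubini, with \<open>1 / (p + r)\<close> as the transform of a single exponential;
  \<open>0 < Re p\<close> gives absolute convergence. This ties the \<open>Q\<close> defined by the
  measure to the Laplace transform of \<open>G\<close>.\<close>

lemma laplace_represents:
  assumes rep: "represents \<mu> G" and int: "set_integrable \<mu> {0..} (\<lambda>r. 1 / (1 + r))" and p: "0 < Re p"
  shows "laplace G p = (LINT r:{0..}|\<mu>. 1 / (p + complex_of_real r))"
proof -
  have radon: "radon_on {0..} \<mu>" using rep by (simp add: represents_def)
  then have sets[measurable_cong]: "sets \<mu> = sets borel" by (simp add: radon_on_def)
  define K where "K r t = exp (- (p + complex_of_real r) * complex_of_real t)" for r t
  have "laplace G p = (LINT t:{0<..}|lborel. (LINT r:{0..}|\<mu>. K r t))"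
    unfolding laplace_def
  proof (rule set_lebesgue_integral_cong, simp, intro allI impI)
    fix t :: real assume "t \<in> {0<..}"
    then have "complex_of_real (G t) = (LINT r:{0..}|\<mu>. complex_of_real (exp (- r * t)))"
      using rep unfolding represents_def by (simp add: set_integral_complex_of_real)
    then have "complex_of_real (G t) * exp (- p * complex_of_real t) =
        (LINT r:{0..}|\<mu>. complex_of_real (exp (- r * t)) * exp (- p * complex_of_real t))"
      by simp
    also have "\<dots> = (LINT r:{0..}|\<mu>. K r t)"
      by (simp add: K_def exp_of_real[symmetric] exp_add[symmetric] algebra_simps)
    finally show "complex_of_real (G t) * exp (- p * complex_of_real t) = (LINT r:{0..}|\<mu>. K r t)" .
  qed
  also have "\<dots> = (LINT r:{0..}|\<mu>. (LINT t:{0<..}|lborel. K r t))"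
  proof (rule fubini_kernel(1)[OF sigma_finite_radon[OF radon] sets])
    show "(\<lambda>(r, t). K r t) \<in> borel_measurable (borel \<Otimes>\<^sub>M borel)"
      unfolding K_def by measurable
    fix r :: real assume r: "r \<in> {0..}"
    then have pr: "0 < Re (p + complex_of_real r)" using p by simp
    show "set_integrable lborel {0<..} (K r)"
      unfolding K_def[abs_def] by (rule exp_laplace(1)[OF pr])
    show "(LINT t:{0<..}|lborel. norm (K r t)) = 1 / (Re p + r)"
      using exp_laplace(3)[OF pr] by (simp add: K_def)
  next
    show "set_integrable \<mu> {0..} (\<lambda>r. 1 / (Re p + r))"
      by (rule stieltjes_kernel_integrable_real[OF sets _ _ int p]) auto
  qed simp
  also have "\<dots> = (LINT r:{0..}|\<mu>. 1 / (p + complex_of_real r))"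
  proof (rule set_lebesgue_integral_cong, use sets in simp, intro allI impI)
    fix r :: real assume "r \<in> {0..}"
    then show "(LINT t:{0<..}|lborel. K r t) = 1 / (p + complex_of_real r)"
      using p unfolding K_def by (intro exp_laplace(2)) simp
  qed
  finally show ?thesis .
qed

section \<open>Typically real functions\<close>

lemma sin_orthogonal:
  "has_bochner_integral lborel (\<lambda>t. indicator {0..pi} t *\<^sub>R (sin (real n * t) * sin (real k * t)))
     (if n = k \<and> k \<noteq> 0 then pi / 2 else 0)"
proof -
  consider "n = k" "k = 0" | "n = k" "k \<noteq> 0" | "n \<noteq> k" by blast
  then show ?thesis
  proof cases
    case 1
    then show ?thesis by (simp add: has_bochner_integral_zero)
  next
    case 2
    have "has_bochner_integral lborel (\<lambda>t. indicator {0..pi} t *\<^sub>R (sin (real k * t) * sin (real k * t)))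
      ((pi / 2 - sin (2 * real k * pi) / (4 * real k)) - (0 / 2 - sin (2 * real k * 0) / (4 * real k)))"
    proof (rule has_bochner_integral_FTC_Icc)
      fix t :: real
      have s: "sin (real k * t) * sin (real k * t) = 1 / 2 - cos (2 * real k * t) / 2"
        using cos_double_sin[of "real k * t"] by (simp add: power2_eq_square mult.assoc diff_divide_distrib)
      have "((\<lambda>t. t / 2 - sin (2 * real k * t) / (4 * real k)) has_real_derivative
          sin (real k * t) * sin (real k * t)) (at t within {0..pi})"
        unfolding s using 2 by (auto intro!: derivative_eq_intros simp: field_simps)
      then show "((\<lambda>t. t / 2 - sin (2 * real k * t) / (4 * real k)) has_vector_derivative
          sin (real k * t) * sin (real k * t)) (at t within {0..pi})"
        by (simp add: has_real_derivative_iff_has_vector_derivative)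
    qed (auto intro!: continuous_intros)
    moreover have "sin (2 * real k * pi) = 0"
      using sin_npi[of "2 * k"] by simp
    ultimately show ?thesis using 2 by simp
  next
    case 3
    define a b where "a = real n - real k" and "b = real n + real k"
    have ab: "a \<noteq> 0" "b \<noteq> 0" using 3 by (auto simp: a_def b_def)
    have "has_bochner_integral lborel (\<lambda>t. indicator {0..pi} t *\<^sub>R (sin (real n * t) * sin (real k * t)))
      ((sin (a * pi) / (2 * a) - sin (b * pi) / (2 * b)) - (sin (a * 0) / (2 * a) - sin (b * 0) / (2 * b)))"
    proof (rule has_bochner_integral_FTC_Icc)
      fix t :: real
      have s: "sin (real n * t) * sin (real k * t) = cos (a * t) / 2 - cos (b * t) / 2"
        by (simp add: sin_times_sin a_def b_def left_diff_distrib distrib_right diff_divide_distrib)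
      have "((\<lambda>t. sin (a * t) / (2 * a) - sin (b * t) / (2 * b)) has_real_derivative
          sin (real n * t) * sin (real k * t)) (at t within {0..pi})"
        unfolding s using ab by (auto intro!: derivative_eq_intros simp: field_simps)
      then show "((\<lambda>t. sin (a * t) / (2 * a) - sin (b * t) / (2 * b)) has_vector_derivative
          sin (real n * t) * sin (real k * t)) (at t within {0..pi})"
        by (simp add: has_real_derivative_iff_has_vector_derivative)
    qed (auto intro!: continuous_intros)
    moreover have "sin (a * pi) = 0" "sin (b * pi) = 0"
      using sin_npi[of n] sin_npi[of k]
      by (simp_all add: a_def b_def left_diff_distrib distrib_right sin_diff sin_add)
    ultimately show ?thesis using 3 by simp
  qed
qed

text \<open>For \<open>t = 0\<close> this is the Koebe function
  \<open>w / (1 - w)\<^sup>2\<close>.\<close>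

definition typ_kernel :: "complex \<Rightarrow> real \<Rightarrow> complex" where
  "typ_kernel w t = w / (1 - 2 * w * complex_of_real (cos t) + w\<^sup>2)"

lemma typ_denominator:
  "1 - 2 * w * complex_of_real (cos t) + w\<^sup>2 = (1 - w * cis t) * (1 - w * cis (- t))"
proof -
  have "cis t + cis (- t) = 2 * complex_of_real (cos t)" by (simp add: complex_eq_iff)
  moreover have "cis t * cis (- t) = 1" by (simp add: cis_mult)
  moreover have "(1 - w * cis t) * (1 - w * cis (- t)) = 1 - w * (cis t + cis (- t)) + w\<^sup>2 * (cis t * cis (- t))"
    by (simp add: algebra_simps power2_eq_square)
  ultimately show ?thesis by (simp add: algebra_simps)
qed

lemma norm_one_minus_cis:
  assumes "norm w < 1"
  shows "1 - norm w \<le> norm (1 - w * cis t)"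
  using norm_triangle_ineq2[of 1 "w * cis t"] by (simp add: norm_mult)

lemma typ_denominator_bound:
  assumes "norm w < 1"
  shows "(1 - norm w)\<^sup>2 \<le> norm (1 - 2 * w * complex_of_real (cos t) + w\<^sup>2)"
  unfolding typ_denominator norm_mult
  using assms by (subst power2_eq_square) (intro mult_mono norm_one_minus_cis, auto)

lemma typ_denominator_ne_0:
  assumes "norm w < 1"
  shows "1 - 2 * w * complex_of_real (cos t) + w\<^sup>2 \<noteq> 0"
  using typ_denominator_bound[OF assms, of t] assms by auto

lemma typ_kernel_bound:
  assumes "norm w < 1"
  shows "norm (typ_kernel w t) \<le> 1 / (1 - norm w)\<^sup>2"
  unfolding typ_kernel_def norm_divide using assms
  by (intro frac_le typ_denominator_bound) auto

lemma typ_kernel_isCont: "norm w < 1 \<Longrightarrow> isCont (typ_kernel w) t"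
  unfolding typ_kernel_def[abs_def]
  by (intro continuous_intros) (use typ_denominator_ne_0 in auto)

text \<open>Partial fractions: the difference of the geometric series of \<open>w * cis t\<close>
  and \<open>w * cis (- t)\<close>. The factor \<open>sin t\<close> stays on the right, so that
  \<open>t = 0\<close> and \<open>t = pi\<close> are covered; it is also the weight in the
  measures.\<close>

lemma typ_kernel_sums:
  assumes w: "norm w < 1"
  shows "(\<lambda>k. w ^ k * complex_of_real (sin (real k * t))) sums (typ_kernel w t * complex_of_real (sin t))"
proof -
  have n: "norm (w * cis s) < 1" for s using w by (simp add: norm_mult)
  have nz: "1 - w * cis s \<noteq> 0" for s using n[of s] by auto
  have "(\<lambda>k. ((w * cis t) ^ k - (w * cis (- t)) ^ k) / (2 * \<i>)) sums
      ((1 / (1 - w * cis t) - 1 / (1 - w * cis (- t))) / (2 * \<i>))"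
    by (intro sums_divide sums_diff geometric_sums n)
  also have "(\<lambda>k. ((w * cis t) ^ k - (w * cis (- t)) ^ k) / (2 * \<i>)) = (\<lambda>k. w ^ k * complex_of_real (sin (real k * t)))"
  proof
    fix k
    have "(w * cis t) ^ k - (w * cis (- t)) ^ k = w ^ k * (cis (real k * t) - cis (- (real k * t)))"
      by (simp add: power_mult_distrib Complex.DeMoivre right_diff_distrib)
    also have "cis (real k * t) - cis (- (real k * t)) = 2 * \<i> * complex_of_real (sin (real k * t))"
      by (simp add: complex_eq_iff)
    finally have "(w * cis t) ^ k - (w * cis (- t)) ^ k = w ^ k * complex_of_real (sin (real k * t)) * (2 * \<i>)"
      by (simp only: mult_ac)
    moreover have "2 * \<i> \<noteq> 0" by simp
    ultimately show "((w * cis t) ^ k - (w * cis (- t)) ^ k) / (2 * \<i>) = w ^ k * complex_of_real (sin (real k * t))"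
      using nonzero_divide_eq_eq by blast
  qed
  also have "(1 / (1 - w * cis t) - 1 / (1 - w * cis (- t))) / (2 * \<i>) =
      w * ((cis t - cis (- t)) / (2 * \<i>)) / ((1 - w * cis t) * (1 - w * cis (- t)))"
    using nz[of t] nz[of "- t"] by (simp add: field_simps)
  also have "(cis t - cis (- t)) / (2 * \<i>) = complex_of_real (sin t)"
    by (simp add: complex_eq_iff)
  finally show ?thesis by (simp add: typ_kernel_def typ_denominator)
qed

locale typically_real =
  fixes F :: "complex \<Rightarrow> complex"
  assumes hol: "F holomorphic_on ball 0 1"
    and sym: "\<And>w. w \<in> ball 0 1 \<Longrightarrow> F (cnj w) = cnj (F w)"
    and pos: "\<And>w. w \<in> ball 0 1 \<Longrightarrow> 0 \<le> Im w \<Longrightarrow> 0 \<le> Im (F w)"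
begin

definition coef :: "nat \<Rightarrow> real" where "coef n = Re ((deriv ^^ n) F 0 / fact n)"

text \<open>Symmetry gives \<open>F\<close> a second expansion, with conjugated coefficients; the
  mean of the two has the real coefficients \<open>coef n\<close>.\<close>

lemma sums:
  assumes w: "norm w < 1"
  shows "(\<lambda>n. complex_of_real (coef n) * w ^ n) sums F w"
proof -
  define a where "a n = (deriv ^^ n) F 0 / fact n" for n
  have s: "(\<lambda>n. a n * w ^ n) sums F w" if "norm w < 1" for w
    using holomorphic_power_series[OF hol, of w] that by (simp add: a_def)
  have "(\<lambda>n. cnj (a n * cnj w ^ n)) sums cnj (F (cnj w))"
    using s[of "cnj w"] w by (simp only: sums_cnj complex_mod_cnj)
  then have "(\<lambda>n. cnj (a n) * w ^ n) sums F w" using sym[of w] w by simp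
  from sums_divide[OF sums_add[OF s[OF w] this], of 2]
  show ?thesis
    by (simp add: coef_def a_def[symmetric] distrib_right[symmetric] complex_add_cnj)
qed

lemma at_0: "F 0 = complex_of_real (coef 0)"
proof -
  have "(\<lambda>n. complex_of_real (coef n) * 0 ^ n) sums F 0"
    by (rule sums) simp
  then show ?thesis
    using powser_sums_zero by (rule sums_unique2)
qed

lemma summable_coef: "0 \<le> r \<Longrightarrow> r < 1 \<Longrightarrow> summable (\<lambda>n. \<bar>coef n\<bar> * r ^ n)"
proof -
  assume r: "0 \<le> r" "r < 1"
  define s where "s = (r + 1) / 2"
  have "summable (\<lambda>n. complex_of_real (coef n) * complex_of_real s ^ n)"
    using sums[of "complex_of_real s"] r by (auto simp: s_def sums_iff)
  from powser_insidea[OF this, of "complex_of_real r"] r show ?thesis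
    by (simp add: s_def norm_mult norm_power)
qed

section \<open>Sine series of \<open>Im F\<close> on circles inside the disc\<close>

definition circle_im :: "real \<Rightarrow> real \<Rightarrow> real" where "circle_im r t = Im (F (complex_of_real r * cis t))"

lemma circle_im_sums: "0 \<le> r \<Longrightarrow> r < 1 \<Longrightarrow> (\<lambda>n. coef n * r ^ n * sin (real n * t)) sums circle_im r t"
proof -
  assume r: "0 \<le> r" "r < 1"
  then have "(\<lambda>n. Im (complex_of_real (coef n) * (complex_of_real r * cis t) ^ n)) sums circle_im r t"
    unfolding circle_im_def by (intro sums_Im sums) (simp add: norm_mult)
  also have "(\<lambda>n. Im (complex_of_real (coef n) * (complex_of_real r * cis t) ^ n)) =
      (\<lambda>n. coef n * r ^ n * sin (real n * t))"
    by (simp add: power_mult_distrib Complex.DeMoivre of_real_power[symmetric] mult.assoc del: of_real_power)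
  finally show ?thesis .
qed

lemma circle_im_nonneg: "0 \<le> r \<Longrightarrow> r < 1 \<Longrightarrow> t \<in> {0..pi} \<Longrightarrow> 0 \<le> circle_im r t"
  unfolding circle_im_def by (intro pos) (auto simp: norm_mult sin_ge_zero)

lemma circle_im_measurable: "0 \<le> r \<Longrightarrow> r < 1 \<Longrightarrow> circle_im r \<in> borel_measurable borel"
proof -
  assume r: "0 \<le> r" "r < 1"
  have "continuous_on UNIV (\<lambda>t. F (complex_of_real r * cis t))"
    by (rule continuous_on_compose2[OF holomorphic_on_imp_continuous_on[OF hol]])
       (use r in \<open>auto intro!: continuous_intros simp: norm_mult\<close>)
  then have "continuous_on UNIV (circle_im r)" unfolding circle_im_def by (intro continuous_intros)
  then show ?thesis by (rule borel_measurable_continuous_onI)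
qed

lemma circle_im_bound: "0 \<le> r \<Longrightarrow> r < 1 \<Longrightarrow> \<bar>circle_im r t\<bar> \<le> (\<Sum>n. \<bar>coef n\<bar> * r ^ n)"
proof -
  assume r: "0 \<le> r" "r < 1"
  have b: "\<bar>coef n * r ^ n * sin (real n * t)\<bar> \<le> \<bar>coef n\<bar> * r ^ n" for n
    using mult_left_mono[of "\<bar>sin (real n * t)\<bar>" 1 "\<bar>coef n\<bar> * r ^ n"] r by (simp add: abs_mult)
  show ?thesis
    using circle_im_sums[OF r, of t] summable_coef[OF r] b norm_suminf_le[of "\<lambda>n. coef n * r ^ n * sin (real n * t)"]
    by (simp add: sums_iff)
qed

text \<open>Termwise integration of the sine series, justified by absolute summability of
  \<open>coef n * r ^ n\<close>; orthogonality leaves the term \<open>n = k\<close>.\<close>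

lemma circle_im_integral:
  assumes r: "0 \<le> r" "r < 1" and k: "k \<noteq> 0"
  shows "has_bochner_integral lborel (\<lambda>t. indicator {0..pi} t *\<^sub>R (circle_im r t * sin (real k * t))) (coef k * r ^ k * (pi / 2))"
proof -
  define f where "f n t = coef n * r ^ n * (indicator {0..pi} t *\<^sub>R (sin (real n * t) * sin (real k * t)))" for n t
  have f: "has_bochner_integral lborel (f n) (if n = k then coef k * r ^ k * (pi / 2) else 0)" for n
    unfolding f_def[abs_def]
    using has_bochner_integral_mult_right[OF sin_orthogonal[of n k], of "coef n * r ^ n"] k by (auto split: if_splits)
  have f_bd: "norm (f n t) \<le> (\<bar>coef n\<bar> * r ^ n) * indicator {0..pi} t" for n t
  proof -
    have "\<bar>sin (real n * t)\<bar> * \<bar>sin (real k * t)\<bar> \<le> 1 * 1" by (intro mult_mono) auto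
    from mult_left_mono[OF this, of "\<bar>coef n\<bar> * r ^ n"]
    show ?thesis using r by (auto simp: f_def abs_mult indicator_def)
  qed
  have ind: "integrable lborel (\<lambda>t. (\<bar>coef n\<bar> * r ^ n) * indicator {0..pi} t :: real)" for n
    by (intro integrable_mult_right) (simp add: integrable_indicator_iff)
  have int_bd: "(LINT t|lborel. norm (f n t)) \<le> (\<bar>coef n\<bar> * r ^ n) * pi" for n
  proof -
    have "(LINT t|lborel. norm (f n t)) \<le> (LINT t|lborel. (\<bar>coef n\<bar> * r ^ n) * indicator {0..pi} t)"
      using f[of n] f_bd ind by (intro integral_mono integrable_norm) (auto simp: has_bochner_integral_iff)
    then show ?thesis by simp
  qed
  have sum1: "AE t in lborel. summable (\<lambda>n. norm (f n t))"
  proof (rule AE_I2)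
    fix t
    show "summable (\<lambda>n. norm (f n t))"
      by (rule summable_comparison_test'[OF summable_mult2[OF summable_coef[OF r], of "indicator {0..pi} t"], of 0])
         (use f_bd in auto)
  qed
  have sum2: "summable (\<lambda>n. LINT t|lborel. norm (f n t))"
    by (rule summable_comparison_test'[OF summable_mult2[OF summable_coef[OF r], of pi], of 0])
       (use int_bd in \<open>auto intro: integral_nonneg\<close>)
  have fi: "integrable lborel (f n)" for n using f[of n] by (simp add: has_bochner_integral_iff)
  have eq: "(\<Sum>n. f n t) = indicator {0..pi} t *\<^sub>R (circle_im r t * sin (real k * t))" for t
    using sums_mult2[OF circle_im_sums[OF r, of t], of "indicator {0..pi} t * sin (real k * t)"]
    by (simp add: f_def sums_iff mult_ac)
  have "(\<lambda>n. LINT t|lborel. f n t) sums (LINT t|lborel. (\<Sum>n. f n t))"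
    by (rule sums_integral[OF fi sum1 sum2])
  moreover have "(\<lambda>n. LINT t|lborel. f n t) sums (coef k * r ^ k * (pi / 2))"
    using sums_single[of k "\<lambda>n. coef k * r ^ k * (pi / 2)"] f
    by (simp add: has_bochner_integral_iff cong: if_cong)
  ultimately have "(LINT t|lborel. (\<Sum>n. f n t)) = coef k * r ^ k * (pi / 2)"
    by (rule sums_unique2)
  then show ?thesis
    using integrable_suminf[OF fi sum1 sum2] by (simp add: eq has_bochner_integral_iff)
qed

text \<open>Expanding the kernel in powers of \<open>w\<close> makes each sine integral contribute
  \<open>coef k * (r * w) ^ k\<close>. The sine series has no term \<open>k = 0\<close>, hence the
  subtraction of \<open>F 0\<close>.\<close>

lemma kernel_integral:
  assumes r: "0 \<le> r" "r < 1" and w: "norm w < 1"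
  shows "(LINT t|lborel. indicator {0..pi} t *\<^sub>R ((circle_im r t * sin t) *\<^sub>R typ_kernel w t)) =
    complex_of_real (pi / 2) * (F (complex_of_real r * w) - F 0)"
proof -
  define C where "C = (\<Sum>n. \<bar>coef n\<bar> * r ^ n)"
  have C0: "0 \<le> C" unfolding C_def using r by (intro suminf_nonneg summable_coef) auto
  define f where "f k t = w ^ k * complex_of_real (indicator {0..pi} t *\<^sub>R (circle_im r t * sin (real k * t)))" for k t
  have f: "has_bochner_integral lborel (f k) (if k = 0 then 0 else w ^ k * complex_of_real (coef k * r ^ k * (pi / 2)))" for k
  proof (cases "k = 0")
    case True
    then show ?thesis by (simp add: f_def[abs_def] has_bochner_integral_zero)
  next
    case False
    then show ?thesis unfolding f_def[abs_def]
      using has_bochner_integral_mult_right[OF has_bochner_integral_of_real[OF circle_im_integral[OF r False]], of "w ^ k"] by simp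
  qed
  have f_bd: "norm (f k t) \<le> norm w ^ k * (C * indicator {0..pi} t)" for k t
  proof -
    have "\<bar>circle_im r t\<bar> * \<bar>sin (real k * t)\<bar> \<le> C * 1"
      using circle_im_bound[OF r, of t] C0 by (intro mult_mono) (auto simp: C_def)
    from mult_left_mono[OF this, of "norm w ^ k"]
    show ?thesis by (auto simp: f_def norm_mult norm_power abs_mult indicator_def)
  qed
  have ind: "integrable lborel (\<lambda>t. norm w ^ k * (C * indicator {0..pi} t :: real))" for k
    by (intro integrable_mult_right) (simp add: integrable_indicator_iff)
  have int_bd: "(LINT t|lborel. norm (f k t)) \<le> norm w ^ k * (C * pi)" for k
  proof -
    have "(LINT t|lborel. norm (f k t)) \<le> (LINT t|lborel. norm w ^ k * (C * indicator {0..pi} t))"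
      using f[of k] f_bd ind by (intro integral_mono integrable_norm) (auto simp: has_bochner_integral_iff)
    then show ?thesis by simp
  qed
  have gs: "summable (\<lambda>k. norm w ^ k * c)" for c
    using w by (intro summable_mult2 summable_geometric) auto
  have sum1: "AE t in lborel. summable (\<lambda>k. norm (f k t))"
  proof (rule AE_I2)
    fix t
    show "summable (\<lambda>k. norm (f k t))"
      by (rule summable_comparison_test'[OF gs[of "C * indicator {0..pi} t"], of 0])
         (use f_bd in auto)
  qed
  have sum2: "summable (\<lambda>k. LINT t|lborel. norm (f k t))"
    by (rule summable_comparison_test'[OF gs[of "C * pi"], of 0])
       (use int_bd in \<open>auto intro: integral_nonneg\<close>)
  have fi: "integrable lborel (f k)" for k using f[of k] by (simp add: has_bochner_integral_iff)
  have eq: "(\<Sum>k. f k t) = indicator {0..pi} t *\<^sub>R ((circle_im r t * sin t) *\<^sub>R typ_kernel w t)" for t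
    using sums_mult2[OF typ_kernel_sums[OF w, of t], of "complex_of_real (indicator {0..pi} t * circle_im r t)"]
    by (simp add: f_def sums_iff mult_ac scaleR_conv_of_real)
  have "(\<lambda>k. LINT t|lborel. f k t) sums (LINT t|lborel. (\<Sum>k. f k t))"
    by (rule sums_integral[OF fi sum1 sum2])
  moreover have "(\<lambda>k. LINT t|lborel. f k t) sums (complex_of_real (pi / 2) * (F (complex_of_real r * w) - F 0))"
  proof -
    have rw: "norm (complex_of_real r * w) < 1"
      using w r mult_strict_mono'[of r 1 "norm w" 1] by (simp add: norm_mult)
    have "(\<lambda>k. complex_of_real (pi / 2) * (complex_of_real (coef k) * (complex_of_real r * w) ^ k - (if k = 0 then F 0 else 0)))
      sums (complex_of_real (pi / 2) * (F (complex_of_real r * w) - F 0))"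
      using sums_single[of 0 "\<lambda>_. F 0"] by (intro sums_mult sums_diff sums rw) (simp add: eq_commute)
    also have "(\<lambda>k. complex_of_real (pi / 2) * (complex_of_real (coef k) * (complex_of_real r * w) ^ k - (if k = 0 then F 0 else 0))) =
       (\<lambda>k. LINT t|lborel. f k t)"
    proof
      fix k
      show "complex_of_real (pi / 2) * (complex_of_real (coef k) * (complex_of_real r * w) ^ k - (if k = 0 then F 0 else 0)) =
       (LINT t|lborel. f k t)"
        using f[of k] at_0 by (auto simp: has_bochner_integral_iff power_mult_distrib)
    qed
    finally show ?thesis .
  qed
  ultimately have "(LINT t|lborel. (\<Sum>k. f k t)) = complex_of_real (pi / 2) * (F (complex_of_real r * w) - F 0)"
    by (rule sums_unique2)
  then show ?thesis by (simp only: eq)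
qed

text \<open>Up to a positive factor \<open>coef 1\<close> is the integral of
  \<open>circle_im r t * sin t\<close>, nonnegative on \<open>{0..pi}\<close>; the radius 1/2 is an
  arbitrary choice.\<close>

lemma coef_1_nonneg: "0 \<le> coef 1"
proof -
  have "0 \<le> (LINT t|lborel. indicator {0..pi} t *\<^sub>R (circle_im (1/2) t * sin (real 1 * t)))"
    by (intro integral_nonneg_AE AE_I2) (auto simp: indicator_def circle_im_nonneg sin_ge_zero)
  then have "0 \<le> coef 1 * (1/2) ^ 1 * (pi / 2)"
    using has_bochner_integral_integral_eq[OF circle_im_integral[of "1/2" 1]] by simp
  then show ?thesis using pi_gt_zero by (simp add: zero_le_mult_iff not_le[symmetric])
qed

text \<open>A nonnegative function with integral 0 vanishes almost everywhere. As
  \<open>sin t > 0\<close> inside \<open>{0..pi}\<close>, \<open>Im F\<close> vanishes on the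
  half-circle, and with it all coefficients but the zeroth. This settles the case in which the mass
  cannot be normalized.\<close>

lemma coef_1_eq_0:
  assumes "coef 1 = 0" and w: "norm w < 1"
  shows "F w = F 0"
proof -
  define f where "f t = indicator {0..pi} t *\<^sub>R (circle_im (1/2) t * sin (real 1 * t))" for t
  have "has_bochner_integral lborel f 0"
    using circle_im_integral[of "1/2" 1] assms by (simp add: f_def[abs_def])
  moreover have "0 \<le> f t" for t
    by (auto simp: f_def indicator_def circle_im_nonneg sin_ge_zero)
  ultimately have f0: "AE t in lborel. f t = 0"
    using integral_nonneg_eq_0_iff_AE[of lborel f] by (simp add: has_bochner_integral_iff)
  have c0: "coef k = 0" if k: "k \<noteq> 0" for k
  proof -
    have "AE t in lborel. t \<noteq> 0 \<and> t \<noteq> pi"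
      by (intro AE_conjI AE_lborel_singleton)
    with f0 have "AE t in lborel. indicator {0..pi} t *\<^sub>R (circle_im (1/2) t * sin (real k * t)) = 0"
    proof eventually_elim
      case (elim t)
      then show ?case using sin_gt_zero[of t] by (auto simp: f_def indicator_def split: if_splits)
    qed
    then have "(LINT t|lborel. indicator {0..pi} t *\<^sub>R (circle_im (1/2) t * sin (real k * t))) = 0"
      by (rule integral_eq_zero_AE)
    then show ?thesis
      using circle_im_integral[of "1/2" k] k by (auto simp: has_bochner_integral_iff)
  qed
  have "(\<lambda>n. complex_of_real (coef n) * w ^ n) = (\<lambda>n. if n = 0 then complex_of_real (coef 0) else 0)"
    using c0 by auto
  then show ?thesis
    using sums[OF w] sums_single[of 0 "\<lambda>_. complex_of_real (coef 0)"] at_0 sums_unique2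
    by (metis (no_types, lifting) sums_unique)
qed

text \<open>The constant is the reciprocal of the mass \<open>coef 1 * r * (pi / 2)\<close> from
  \<open>circle_im_integral\<close> with \<open>k = 1\<close>.\<close>

definition rogosinski :: "real \<Rightarrow> real measure" where
  "rogosinski r = density lborel (\<lambda>t. ennreal (indicator {0..pi} t * (circle_im r t * sin t) * (2 / (pi * (coef 1 * r)))))"

lemma rogosinski_distribution:
  assumes r: "0 < r" "r < 1" and c: "0 < coef 1"
  shows "real_distribution (rogosinski r)"
    and "Sigma_Algebra.measure (rogosinski r) {-1<..4} = 1"
    and "norm w < 1 \<Longrightarrow> (LINT t|rogosinski r. typ_kernel w t) = (F (complex_of_real r * w) - F 0) / complex_of_real (coef 1 * r)"
proof -
  define d where "d t = indicator {0..pi} t * (circle_im r t * sin t) * (2 / (pi * (coef 1 * r)))" for t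
  have [measurable]: "circle_im r \<in> borel_measurable borel" using circle_im_measurable r by simp
  have d_meas[measurable]: "d \<in> borel_measurable borel" unfolding d_def[abs_def] by measurable
  have d0: "0 \<le> d t" for t
    using r c by (auto simp: d_def indicator_def circle_im_nonneg sin_ge_zero)
  have "has_bochner_integral lborel d (coef 1 * r ^ 1 * (pi / 2) * (2 / (pi * (coef 1 * r))))"
    using has_bochner_integral_mult_left[OF circle_im_integral[of r 1], of "2 / (pi * (coef 1 * r))"] r
    by (simp add: d_def[abs_def])
  then have "has_bochner_integral lborel d 1" using r c by simp
  then have "(\<integral>\<^sup>+t. ennreal (d t) \<partial>lborel) = ennreal 1"
    using d0 unfolding has_bochner_integral_iff by (subst nn_integral_eq_integral) auto
  then interpret prob_space "rogosinski r"
    unfolding rogosinski_def d_def[symmetric] by (intro prob_spaceI) (simp add: emeasure_density)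
  show rd: "real_distribution (rogosinski r)"
    unfolding real_distribution_def real_distribution_axioms_def
    using prob_space_axioms by (simp add: rogosinski_def)
  \<comment> \<open>A half-open interval that contains \<open>{0..pi}\<close> for every
    radius.\<close>
  have "AE t in rogosinski r. t \<in> {-1<..4}"
    unfolding rogosinski_def d_def[symmetric] using pi_less_4
    by (subst AE_density) (auto simp: d_def indicator_def intro!: AE_I2)
  then show "Sigma_Algebra.measure (rogosinski r) {-1<..4} = 1"
    by (intro prob_eq_1[THEN iffD2]) (auto simp: rogosinski_def)
  assume w: "norm w < 1"
  have [measurable]: "typ_kernel w \<in> borel_measurable borel"
    unfolding typ_kernel_def[abs_def] by measurable
  have "(LINT t|rogosinski r. typ_kernel w t) = (LINT t|lborel. d t *\<^sub>R typ_kernel w t)"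
    unfolding rogosinski_def d_def[symmetric] using d0 by (intro integral_density) auto
  also have "\<dots> = (LINT t|lborel. (2 / (pi * (coef 1 * r))) *\<^sub>R (indicator {0..pi} t *\<^sub>R ((circle_im r t * sin t) *\<^sub>R typ_kernel w t)))"
    by (simp add: d_def mult_ac)
  also have "\<dots> = (2 / (pi * (coef 1 * r))) *\<^sub>R (complex_of_real (pi / 2) * (F (complex_of_real r * w) - F 0))"
    using r by (simp only: integral_scaleR_right kernel_integral[OF _ r(2) w] less_imp_le)
  also have "\<dots> = (F (complex_of_real r * w) - F 0) / complex_of_real (coef 1 * r)"
    using r c by (simp add: scaleR_conv_of_real field_simps)
  finally show "(LINT t|rogosinski r. typ_kernel w t) = (F (complex_of_real r * w) - F 0) / complex_of_real (coef 1 * r)" .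
qed

theorem rogosinski_representation:
  obtains b P where "0 \<le> b" "real_distribution P"
    "\<And>w. norm w < 1 \<Longrightarrow> F w = F 0 + complex_of_real b * (LINT t|P. typ_kernel w t)"
proof (cases "coef 1 = 0")
  case True
  \<comment> \<open>Here \<open>F\<close> is constant and \<open>b = 0\<close>, so any probability
    measure will do.\<close>
  have rd: "real_distribution (return borel 0)"
    using prob_space_return[of 0 "borel :: real measure"]
    by (simp add: real_distribution_def real_distribution_axioms_def)
  show ?thesis
  proof (rule that[OF order_refl rd])
    fix w :: complex assume "norm w < 1"
    from coef_1_eq_0[OF True this]
    show "F w = F 0 + complex_of_real 0 * (LINT t|return borel 0. typ_kernel w t)" by simp
  qed
next
  case False
  then have c: "0 < coef 1" using coef_1_nonneg by simp
  define \<rho> where "\<rho> n = 1 - 1 / (real n + 2)" for n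
  have \<rho>: "0 < \<rho> n" "\<rho> n < 1" for n by (auto simp: \<rho>_def field_simps)
  have \<rho>_lim: "\<rho> \<longlonglongrightarrow> 1" unfolding \<rho>_def by real_asymp
  define M where "M n = rogosinski (\<rho> n)" for n
  have M: "real_distribution (M n)" "Sigma_Algebra.measure (M n) {-1<..4} = 1" for n
    using rogosinski_distribution(1,2)[OF \<rho> c] by (auto simp: M_def)
  have "tight M"
    unfolding tight_def
  proof (intro conjI allI impI M(1))
    fix \<epsilon> :: real assume "0 < \<epsilon>"
    then have "-1 < (4::real) \<and> (\<forall>n. 1 - \<epsilon> < Sigma_Algebra.measure (M n) {-1<..4})"
      using M(2) by simp
    then show "\<exists>a b. a < b \<and> (\<forall>n. 1 - \<epsilon> < Sigma_Algebra.measure (M n) {a<..b})"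
      by blast
  qed
  then obtain s P where s: "strict_mono (s :: nat \<Rightarrow> nat)" and P: "real_distribution P"
    and lim: "weak_conv_m (M \<circ> id \<circ> s) P"
    using tight_imp_convergent_subsubsequence[of M id] by (auto simp: strict_mono_def)
  have Ms: "real_distribution ((M \<circ> id \<circ> s) n)" for n
    unfolding o_def id_def by (rule M)
  have "F w = F 0 + complex_of_real (coef 1) * (LINT t|P. typ_kernel w t)" if w: "norm w < 1" for w
  proof -
    \<comment> \<open>For fixed \<open>w\<close> the kernel is bounded and continuous in
      \<open>t\<close>, as weak convergence requires. The second limit is continuity of
      \<open>F\<close> at \<open>w\<close>.\<close>
    have "(\<lambda>n. LINT t|(M \<circ> id \<circ> s) n. typ_kernel w t) \<longlonglongrightarrow> (LINT t|P. typ_kernel w t)"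
      using typ_kernel_isCont[OF w] typ_kernel_bound[OF w]
      by (rule weak_conv_imp_integral_bdd_continuous_conv[OF Ms P lim])
    moreover have "(\<lambda>n. LINT t|(M \<circ> id \<circ> s) n. typ_kernel w t) \<longlonglongrightarrow> (F w - F 0) / complex_of_real (coef 1)"
    proof -
      have r: "(\<lambda>n. \<rho> (s n)) \<longlonglongrightarrow> 1"
        using LIMSEQ_subseq_LIMSEQ[OF \<rho>_lim s] by (simp add: comp_def)
      have rw: "(\<lambda>n. complex_of_real (\<rho> (s n)) * w) \<longlonglongrightarrow> w"
        using tendsto_mult[OF tendsto_of_real[OF r] tendsto_const[of w]] by simp
      have "isCont F w"
        using w holomorphic_on_imp_continuous_on[OF hol]
        by (intro continuous_on_interior[of "ball 0 1"]) auto
      from isCont_tendsto_compose[OF this rw]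
      have "(\<lambda>n. (F (complex_of_real (\<rho> (s n)) * w) - F 0) / complex_of_real (coef 1 * \<rho> (s n)))
          \<longlonglongrightarrow> (F w - F 0) / complex_of_real (coef 1 * 1)"
        using c by (intro tendsto_intros r) auto
      then show ?thesis
        using rogosinski_distribution(3)[OF \<rho> c w] by (simp add: M_def)
    qed
    ultimately have "(LINT t|P. typ_kernel w t) = (F w - F 0) / complex_of_real (coef 1)"
      by (rule LIMSEQ_unique)
    then show ?thesis using c by simp
  qed
  then show ?thesis by (rule that[OF less_imp_le[OF c] P])
qed

end

section \<open>Stieltjes representation\<close>

text \<open>The square of \<open>sin (t / 2)\<close>. It parametrizes the poles by the unit
  interval: 1 stands for the pole at 0, and 0 for the pole at infinity.\<close>

definition half_angle :: "real \<Rightarrow> real" where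
  "half_angle t = (1 - cos t) / 2"

lemma half_angle_range: "0 \<le> half_angle t" "half_angle t \<le> 1"
  using cos_le_one[of t] cos_ge_minus_one[of t] by (auto simp: half_angle_def)

lemma half_angle_measurable [measurable]: "half_angle \<in> borel_measurable borel"
  unfolding half_angle_def[abs_def] by measurable

text \<open>The expression is the point with parameter \<open>u\<close> on the segment from 1 to
  \<open>p\<close>. Factoring out \<open>u > 0\<close> leaves \<open>p + r\<close> with
  \<open>r \<ge> 0\<close>.\<close>

lemma segment_ne_0:
  assumes p: "p \<in> slit_plane" and u: "0 \<le> u" "u \<le> 1"
  shows "p * complex_of_real u + 1 - complex_of_real u \<noteq> 0"
proof (cases "u = 0")
  case False
  then have "p + complex_of_real ((1 - u) / u) \<noteq> 0"
    using u by (intro slit_plane_add_ne_0[OF p]) auto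
  moreover have "p * complex_of_real u + 1 - complex_of_real u = complex_of_real u * (p + complex_of_real ((1 - u) / u))"
    using False by (simp add: field_simps)
  ultimately show ?thesis using False by simp
qed simp

text \<open>The fraction maps the disc into the right half-plane, which squaring opens to the slit
  plane. The closed upper half of the disc goes to the closed first quadrant and then to the closed
  upper half-plane.\<close>

lemma cayley_slit_plane:
  assumes "norm w < 1"
  shows "((1 + w) / (1 - w))\<^sup>2 \<in> slit_plane" "0 \<le> Im w \<Longrightarrow> 0 \<le> Im (((1 + w) / (1 - w))\<^sup>2)"
proof -
  define z where "z = (1 + w) / (1 - w)"
  have nz: "1 - w \<noteq> 0" using assms by auto
  have "z = (1 + w) * cnj (1 - w) / complex_of_real ((norm (1 - w))\<^sup>2)"
    unfolding z_def by (subst complex_div_cnj) simp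
  moreover have "Re ((1 + w) * cnj (1 - w)) = 1 - (norm w)\<^sup>2" "Im ((1 + w) * cnj (1 - w)) = 2 * Im w"
    unfolding cmod_power2 by (simp_all add: algebra_simps power2_eq_square)
  ultimately have z: "Re z = (1 - (norm w)\<^sup>2) / (norm (1 - w))\<^sup>2" "Im z = 2 * Im w / (norm (1 - w))\<^sup>2"
    by (simp_all add: Re_divide_of_real Im_divide_of_real)
  have "(norm w)\<^sup>2 < 1" using assms mult_strict_mono'[of "norm w" 1 "norm w" 1]
    by (simp add: power2_eq_square)
  then have Re: "0 < Re z" using nz by (simp add: z)
  have sq: "Im (z\<^sup>2) = 2 * Re z * Im z" "Re (z\<^sup>2) = (Re z)\<^sup>2 - (Im z)\<^sup>2"
    by (simp_all add: power2_eq_square)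
  show "((1 + w) / (1 - w))\<^sup>2 \<in> slit_plane"
    unfolding z_def[symmetric] slit_plane_iff sq using Re by (auto simp: power2_eq_square mult_le_0_iff)
  assume "0 \<le> Im w"
  then have "0 \<le> Im z" by (simp add: z(2))
  then show "0 \<le> Im (((1 + w) / (1 - w))\<^sup>2)"
    unfolding z_def[symmetric] sq using Re by simp
qed

lemma slit_plane_csqrt_Re:
  assumes p: "p \<in> slit_plane"
  shows "0 < Re (csqrt p)"
proof (rule ccontr)
  assume "\<not> 0 < Re (csqrt p)"
  then have "Re (csqrt p) = 0" using csqrt_principal[of p] by auto
  then have "Im ((csqrt p)\<^sup>2) = 0" "Re ((csqrt p)\<^sup>2) \<le> 0"
    by (simp_all add: power2_eq_square)
  then show False using p by (simp add: slit_plane_iff)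
qed

text \<open>The inverse substitution works because \<open>s = csqrt p\<close> has positive real
  part, which means \<open>norm (s - 1) < norm (s + 1)\<close>.\<close>

lemma cayley_inverse:
  assumes p: "p \<in> slit_plane"
  defines "w \<equiv> (csqrt p - 1) / (csqrt p + 1)"
  shows "norm w < 1" "((1 + w) / (1 - w))\<^sup>2 = p"
    "typ_kernel w t = (p - 1) / (4 * (p * complex_of_real (half_angle t) + 1 - complex_of_real (half_angle t)))"
proof -
  define s where "s = csqrt p"
  have s: "0 < Re s" "s\<^sup>2 = p" using slit_plane_csqrt_Re[OF p] by (auto simp: s_def)
  have nz: "s + 1 \<noteq> 0" using s by (auto simp: complex_eq_iff)
  have ws: "w = (s - 1) / (s + 1)" by (simp add: w_def s_def)
  have "norm (s - 1) < norm (s + 1)"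
    unfolding cmod_def by (rule real_sqrt_less_mono) (use s in \<open>simp add: power2_eq_square algebra_simps\<close>)
  then show "norm w < 1" using nz by (simp add: ws norm_divide)
  have "1 + w = 2 * s / (s + 1)" "1 - w = 2 / (s + 1)"
    using nz by (simp_all add: ws field_simps)
  then have "(1 + w) / (1 - w) = s" using nz by simp
  then show "((1 + w) / (1 - w))\<^sup>2 = p" using s by simp
  define c where "c = complex_of_real (cos t)"
  \<comment> \<open>Clearing the factor \<open>(s + 1)\<^sup>2\<close> leaves only even powers of
    \<open>s\<close>, that is, an expression in \<open>p\<close>.\<close>
  have "typ_kernel w t = (w * (s + 1)\<^sup>2) / ((1 - 2 * w * c + w\<^sup>2) * (s + 1)\<^sup>2)"
    using nz by (simp add: typ_kernel_def c_def)
  also have "w * (s + 1)\<^sup>2 = p - 1"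
    using nz s(2) by (simp add: ws power2_eq_square) (simp add: algebra_simps)
  also have "(1 - 2 * w * c + w\<^sup>2) * (s + 1)\<^sup>2 = (s + 1)\<^sup>2 - 2 * (w * (s + 1)) * (s + 1) * c + (w * (s + 1))\<^sup>2"
    by (simp add: power2_eq_square algebra_simps)
  also have "w * (s + 1) = s - 1" using nz by (simp add: ws)
  also have "(s + 1)\<^sup>2 - 2 * (s - 1) * (s + 1) * c + (s - 1)\<^sup>2 = 2 * s\<^sup>2 * (1 - c) + 2 * (1 + c)"
    by (simp add: power2_eq_square algebra_simps)
  also have "\<dots> = 4 * (p * complex_of_real (half_angle t) + 1 - complex_of_real (half_angle t))"
    using s(2) by (simp add: half_angle_def c_def algebra_simps add_divide_distrib diff_divide_distrib)
  finally show "typ_kernel w t = (p - 1) / (4 * (p * complex_of_real (half_angle t) + 1 - complex_of_real (half_angle t)))" .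
qed

text \<open>Rogosinski's representation carried over to the slit plane: \<open>w = 0\<close>
  corresponds to \<open>p = 1\<close>, which makes \<open>S 1\<close> the base value, and the factor
  1/4 of the kernel goes into \<open>c\<close>.\<close>

lemma nevanlinna_representation:
  assumes hol: "S holomorphic_on slit_plane"
    and sym: "\<And>p. p \<in> slit_plane \<Longrightarrow> S (cnj p) = cnj (S p)"
    and neg: "\<And>p. p \<in> slit_plane \<Longrightarrow> 0 \<le> Im p \<Longrightarrow> Im (S p) \<le> 0"
  obtains c P where "0 \<le> c" "real_distribution P"
    "\<And>p. p \<in> slit_plane \<Longrightarrow> S p = S 1 - complex_of_real c *
       (LINT t|P. (p - 1) / (p * complex_of_real (half_angle t) + 1 - complex_of_real (half_angle t)))"
proof -
  define F where "F w = - S (((1 + w) / (1 - w))\<^sup>2)" for w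
  interpret typically_real F
  proof
    have "(S \<circ> (\<lambda>w. ((1 + w) / (1 - w))\<^sup>2)) holomorphic_on ball 0 1"
      by (rule holomorphic_on_compose_gen[OF _ hol])
         (use cayley_slit_plane(1) in \<open>auto intro!: holomorphic_intros\<close>)
    then show "F holomorphic_on ball 0 1"
      unfolding F_def[abs_def] comp_def by (intro holomorphic_intros)
    fix w :: complex assume w: "w \<in> ball 0 1"
    then show "F (cnj w) = cnj (F w)"
      using sym[OF cayley_slit_plane(1), of w] by (simp add: F_def)
    assume "0 \<le> Im w"
    then show "0 \<le> Im (F w)"
      using w neg[OF cayley_slit_plane, of w] by (simp add: F_def)
  qed
  obtain b P where b: "0 \<le> b" and P: "real_distribution P"
    and rep: "\<And>w. norm w < 1 \<Longrightarrow> F w = F 0 + complex_of_real b * (LINT t|P. typ_kernel w t)"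
    using rogosinski_representation by blast
  show ?thesis
  proof (rule that[of "b / 4" P])
    fix p assume p: "p \<in> slit_plane"
    note w = cayley_inverse[OF p]
    have "- S p = - S 1 + complex_of_real b * (LINT t|P. (p - 1) / (4 * (p * complex_of_real (half_angle t) + 1 - complex_of_real (half_angle t))))"
      using rep[OF w(1)] w(2) unfolding w(3) F_def by simp
    also have "(\<lambda>t. (p - 1) / (4 * (p * complex_of_real (half_angle t) + 1 - complex_of_real (half_angle t)))) =
        (\<lambda>t. (1 / 4) * ((p - 1) / (p * complex_of_real (half_angle t) + 1 - complex_of_real (half_angle t))))"
      by (simp only: times_divide_times_eq mult_1)
    finally show "S p = S 1 - complex_of_real (b / 4) *
       (LINT t|P. (p - 1) / (p * complex_of_real (half_angle t) + 1 - complex_of_real (half_angle t)))"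
      by (simp only: integral_mult_right_zero) (simp add: field_simps)
  qed (use b P in auto)
qed

text \<open>At \<open>x = n + 1\<close> the kernel is \<open>n / (n * u + 1)\<close>, which
  increases to \<open>1 / u\<close> for \<open>u > 0\<close>; monotone convergence carries the bound
  \<open>s\<close> to the limit.\<close>

lemma half_angle_reciprocal:
  assumes P: "real_distribution P" and c: "0 \<le> c"
    and bound: "\<And>x. 1 < x \<Longrightarrow> c * (LINT t|P. (x - 1) / (x * half_angle t + 1 - half_angle t)) \<le> s"
  shows "AE t in P. c = 0 \<or> half_angle t \<noteq> 0"
    and "integrable P (\<lambda>t. c / half_angle t)" and "(LINT t|P. c / half_angle t) \<le> s"
proof -
  interpret real_distribution P by (rule P)
  define g where "g n t = c * (real n / (real n * half_angle t + 1))" for n :: nat and t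
  have den: "1 \<le> real n * half_angle t + 1" for n t
    using half_angle_range[of t] by simp
  have g_nonneg: "0 \<le> g n t" for n t
    using c den[of n t] by (simp add: g_def)
  have g_le: "g n t \<le> c * real n" for n t
  proof -
    have "real n / (real n * half_angle t + 1) \<le> real n / 1"
      using den[of n t] by (intro divide_left_mono) auto
    from mult_left_mono[OF this c] show ?thesis by (simp add: g_def)
  qed
  have [measurable]: "g n \<in> borel_measurable borel" for n
    unfolding g_def[abs_def] by measurable
  have g_int: "integrable P (g n)" for n
    using g_nonneg g_le by (intro integrable_const_bound[of _ "c * real n"]) (auto intro!: AE_I2)
  have g_bound: "(LINT t|P. g n t) \<le> s" if "0 < n" for n
  proof -
    have e: "(real n + 1) * half_angle t + 1 - half_angle t = real n * half_angle t + 1" for t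
      by (simp add: algebra_simps)
    show ?thesis
      using bound[of "real n + 1"] that unfolding g_def integral_mult_right_zero e by simp
  qed
  \<comment> \<open>Where \<open>u = 0\<close> the kernel equals \<open>n\<close>, so a positive
    mass there would violate the bound for large \<open>n\<close>. This must be excluded separately,
    as \<open>c / 0 = 0\<close> is not the limit of \<open>g n\<close>.\<close>
  have null: "c * prob {t. half_angle t = 0} = 0"
  proof -
    let ?A = "{t. half_angle t = 0}"
    have A[measurable]: "?A \<in> sets borel" by measurable
    have "c * prob ?A \<le> s / real n" if n: "0 < n" for n
    proof -
      have "(LINT t|P. c * real n * indicator ?A t) \<le> (LINT t|P. g n t)"
      proof (rule integral_mono[OF _ g_int])
        show "integrable P (\<lambda>t. c * real n * indicator ?A t :: real)"
          by (intro integrable_mult_right integrable_real_indicator) (auto simp: less_top[symmetric])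
        show "c * real n * indicator ?A t \<le> g n t" for t
          using g_nonneg[of n t] by (auto simp: g_def indicator_def)
      qed
      also have "(LINT t|P. c * real n * indicator ?A t) = c * real n * prob ?A"
        by simp
      finally show ?thesis using g_bound[OF n] n by (simp add: field_simps)
    qed
    moreover have "(\<lambda>n. s / real n) \<longlonglongrightarrow> 0" by real_asymp
    ultimately have "c * prob ?A \<le> 0"
      by (intro LIMSEQ_le_const) (auto intro!: exI[of _ 1])
    then show ?thesis using c by (intro antisym) auto
  qed
  show ae: "AE t in P. c = 0 \<or> half_angle t \<noteq> 0"
  proof (cases "c = 0")
    case False
    then have "prob {t. half_angle t = 0} = 0" using null by simp
    then have "{t. half_angle t = 0} \<in> null_sets P"
      by (intro null_setsI) (auto simp: emeasure_eq_measure)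
    from AE_not_in[OF this] show ?thesis by eventually_elim simp
  qed simp
  have mono: "g m t \<le> g n t" if "m \<le> n" for m n t
  proof -
    have "real m / (real m * half_angle t + 1) \<le> real n / (real n * half_angle t + 1)"
    proof -
      have pm: "0 < real m * half_angle t + 1" and pn: "0 < real n * half_angle t + 1"
        using den[of m t] den[of n t] by linarith+
      have "real m * (real n * half_angle t + 1) \<le> real n * (real m * half_angle t + 1)"
        using that by (simp add: algebra_simps)
      then have "real m \<le> real n * (real m * half_angle t + 1) / (real n * half_angle t + 1)"
        by (simp only: pos_le_divide_eq[OF pn])
      then show ?thesis by (simp only: pos_divide_le_eq[OF pm]) simp
    qed
    then show ?thesis unfolding g_def using c by (rule mult_left_mono)
  qed
  have inc: "incseq (\<lambda>n. LINT t|P. g n t)"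
    using g_int mono by (intro incseq_SucI integral_mono) auto
  have le_s: "(LINT t|P. g n t) \<le> s" for n
    using g_bound[of n] g_bound[of 1] mono[of 0 1] g_int
    by (cases n) (auto intro: order_trans[OF integral_mono])
  obtain L where lim: "(\<lambda>n. LINT t|P. g n t) \<longlonglongrightarrow> L"
    by (rule incseq_convergent[OF inc]) (use le_s in auto)
  have "L \<le> s"
    using le_s by (intro LIMSEQ_le_const2[OF lim]) auto
  have "has_bochner_integral P (\<lambda>t. c / half_angle t) L"
  proof (rule has_bochner_integral_monotone_convergence[OF g_int _ _ lim])
    show "AE t in P. mono (\<lambda>n. g n t)" using mono by (auto intro!: monoI)
    show "AE t in P. (\<lambda>n. g n t) \<longlonglongrightarrow> c / half_angle t"
      using ae
    proof eventually_elim
      case (elim t)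
      show ?case
      proof (cases "c = 0")
        case False
        then have "0 < half_angle t" using elim half_angle_range[of t] by auto
        then have "(\<lambda>n. real n / (real n * half_angle t + 1)) \<longlonglongrightarrow> inverse (half_angle t)"
          by real_asymp
        then have "(\<lambda>n. real n / (real n * half_angle t + 1)) \<longlonglongrightarrow> 1 / half_angle t"
          by (simp only: inverse_eq_divide)
        from tendsto_mult[OF tendsto_const[of c] this] show ?thesis by (simp add: g_def)
      qed (simp add: g_def)
    qed
  qed measurable
  then show "integrable P (\<lambda>t. c / half_angle t)" "(LINT t|P. c / half_angle t) \<le> s"
    using \<open>L \<le> s\<close> by (auto simp: has_bochner_integral_iff)
qed

text \<open>Where \<open>half_angle t = 0\<close> the density is \<open>c / 0 = 0\<close>, so the pole at infinity is dropped.\<close>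

definition pole_measure :: "real \<Rightarrow> real measure \<Rightarrow> real measure" where
  "pole_measure c P = distr (density P (\<lambda>t. ennreal (c / (half_angle t)\<^sup>2))) borel
     (\<lambda>t. (1 - half_angle t) / half_angle t)"

lemma pole_measure:
  fixes h :: "real \<Rightarrow> 'a :: {banach, second_countable_topology}"
  assumes P[measurable_cong]: "sets P = sets borel" and c: "0 \<le> c"
    and [measurable]: "h \<in> borel_measurable borel"
  shows "emeasure (pole_measure c P) (- {0..}) = 0"
    and "set_integrable (pole_measure c P) {0..} h \<longleftrightarrow>
       integrable P (\<lambda>t. (c / (half_angle t)\<^sup>2) *\<^sub>R h ((1 - half_angle t) / half_angle t))"
    and "(LINT r:{0..}|pole_measure c P. h r) =
       (LINT t|P. (c / (half_angle t)\<^sup>2) *\<^sub>R h ((1 - half_angle t) / half_angle t))"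
proof -
  \<comment> \<open>At \<open>half_angle t = 0\<close> the quotient takes the default value 0, so
    every image point lies in \<open>{0..}\<close>; the density vanishes there, and no mass is added
    at 0.\<close>
  have r: "(1 - half_angle t) / half_angle t \<in> {0..}" for t
    using half_angle_range[of t] by auto
  show "emeasure (pole_measure c P) (- {0..}) = 0"
  proof -
    have "(\<lambda>t. (1 - half_angle t) / half_angle t) -` (- {0..}) = {}" using r by blast
    then show ?thesis unfolding pole_measure_def by (subst emeasure_distr) simp_all
  qed
  show "set_integrable (pole_measure c P) {0..} h \<longleftrightarrow>
       integrable P (\<lambda>t. (c / (half_angle t)\<^sup>2) *\<^sub>R h ((1 - half_angle t) / half_angle t))"
    unfolding pole_measure_def set_integrable_def using r c
    by (subst integrable_distr_eq, measurable) (subst integrable_density, auto)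
  show "(LINT r:{0..}|pole_measure c P. h r) =
       (LINT t|P. (c / (half_angle t)\<^sup>2) *\<^sub>R h ((1 - half_angle t) / half_angle t))"
    unfolding pole_measure_def set_lebesgue_integral_def using r c
    by (subst integral_distr, measurable) (subst integral_density, auto)
qed

lemma remove_atom:
  assumes sets[measurable_cong]: "sets \<nu> = sets borel" and neg: "emeasure \<nu> (- {0..}) = 0"
    and zero: "emeasure \<nu> {0} = 0"
    and int: "set_integrable \<nu> {0..} (\<lambda>r. 1 / (1 + r))"
  shows "radon_on {0<..} \<nu>"
    and "set_integrable \<nu> {0<..} (\<lambda>r. 1 / (1 + r))"
    and "f \<in> borel_measurable borel \<Longrightarrow> (LINT r:{0<..}|\<nu>. f r) = (LINT r:{0..}|\<nu>. f r :: complex)"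
proof -
  show int': "set_integrable \<nu> {0<..} (\<lambda>r. 1 / (1 + r))"
    by (rule set_integrable_subset[OF int]) (auto simp: sets)
  show "radon_on {0<..} \<nu>"
    unfolding radon_on_def
  proof (intro conjI allI impI sets)
    have "- {0<..} = - {0..} \<union> {0::real}" by auto
    then have "emeasure \<nu> (- {0<..}) \<le> emeasure \<nu> (- {0..}) + emeasure \<nu> {0}"
      using emeasure_subadditive[of "- {0..}" \<nu> "{0}"] by (simp add: sets)
    then show "emeasure \<nu> (- {0<..}) = 0" using neg zero by simp
    fix K :: "real set" assume K: "compact K \<and> K \<subseteq> {0<..}"
    then obtain R where R: "\<And>r. r \<in> K \<Longrightarrow> r \<le> R"
      by (meson bdd_above.E bounded_imp_bdd_above compact_imp_bounded)
    have "emeasure \<nu> K \<le> emeasure \<nu> ({0<..} \<inter> {..R})"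
      using K R by (intro emeasure_mono) (auto simp: sets)
    also have "\<dots> < \<infinity>"
      by (rule emeasure_bounded_part[OF sets _ _ int']) auto
    finally show "emeasure \<nu> K < \<infinity>" .
  qed
  have ae: "AE r in \<nu>. r \<in> {0..} \<longleftrightarrow> r \<in> {0<..}"
  proof (rule AE_I[where N="{0}"])
    show "emeasure \<nu> {0} = 0" by (rule zero)
  qed (auto simp: sets)
  assume [measurable]: "f \<in> borel_measurable borel"
  show "(LINT r:{0<..}|\<nu>. f r) = (LINT r:{0..}|\<nu>. f r)"
    by (rule set_integral_cong_set[OF _ _ ae]) (simp_all add: set_borel_measurable_def)
qed

text \<open>With \<open>d = p * u + 1 - u\<close>, partial fractions split
  \<open>c * (p - 1) / d\<close> into \<open>c / u - c / (u * d)\<close>. The first term is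
  integrable and joins the constant; the second is a Stieltjes kernel in \<open>p\<close>.\<close>

theorem stieltjes_representation:
  assumes hol: "S holomorphic_on slit_plane"
    and sym: "\<And>p. p \<in> slit_plane \<Longrightarrow> S (cnj p) = cnj (S p)"
    and neg: "\<And>p. p \<in> slit_plane \<Longrightarrow> 0 \<le> Im p \<Longrightarrow> Im (S p) \<le> 0"
    and pos: "\<And>x. 0 < x \<Longrightarrow> 0 \<le> Re (S (complex_of_real x))"
    and bdd: "\<And>x. 0 < x \<Longrightarrow> Re (S (complex_of_real x)) \<le> C"
  obtains B \<nu> where "0 \<le> B" "radon_on {0<..} \<nu>" "set_integrable \<nu> {0<..} (\<lambda>r. 1 / (1 + r))"
    "\<And>p. p \<in> slit_plane \<Longrightarrow> S p = complex_of_real B + (LINT r:{0<..}|\<nu>. 1 / (p + complex_of_real r))"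
proof -
  obtain c P where c: "0 \<le> c" and P: "real_distribution P"
    and rep: "\<And>p. p \<in> slit_plane \<Longrightarrow> S p = S 1 - complex_of_real c *
       (LINT t|P. (p - 1) / (p * complex_of_real (half_angle t) + 1 - complex_of_real (half_angle t)))"
    using nevanlinna_representation[OF hol sym neg] by blast
  interpret real_distribution P by (rule P)
  define u where "u t = half_angle t" for t
  have u: "0 \<le> u t" "u t \<le> 1" for t using half_angle_range by (auto simp: u_def)
  define s where "s = Re (S 1)"
  have S1: "S 1 = complex_of_real s"
    using sym[of 1] slit_plane_of_real[of 1] by (simp add: s_def complex_eq_iff)
  have bound: "c * (LINT t|P. (x - 1) / (x * u t + 1 - u t)) \<le> s" if "1 < x" for x
  proof -
    have "(LINT t|P. (complex_of_real x - 1) / (complex_of_real x * complex_of_real (u t) + 1 - complex_of_real (u t)))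
      = (LINT t|P. complex_of_real ((x - 1) / (x * u t + 1 - u t)))" by simp
    also have "\<dots> = complex_of_real (LINT t|P. (x - 1) / (x * u t + 1 - u t))"
      by (rule integral_complex_of_real)
    finally have "S (complex_of_real x) = complex_of_real (s - c * (LINT t|P. (x - 1) / (x * u t + 1 - u t)))"
      using rep[of "complex_of_real x"] that by (simp add: S1 slit_plane_of_real u_def)
    then show ?thesis using pos[of x] that by simp
  qed
  have rec: "AE t in P. c = 0 \<or> u t \<noteq> 0" "integrable P (\<lambda>t. c / u t)" "(LINT t|P. c / u t) \<le> s"
    using half_angle_reciprocal[OF P c, of s] bound unfolding u_def by blast+
  \<comment> \<open>What remains of \<open>S 1\<close> after the constant terms
    \<open>c / u\<close>; it is nonnegative by the bound on the integral of
    \<open>c / u\<close>.\<close>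
  define B where "B = s - (LINT t|P. c / u t)"
  have B: "0 \<le> B" using rec(3) by (simp add: B_def)
  define \<nu> where "\<nu> = pole_measure c P"
  have sets: "sets \<nu> = sets borel" by (simp add: \<nu>_def pole_measure_def)
  note pole = pole_measure[OF events_eq_borel c, folded \<nu>_def u_def]
  have pole_neg: "emeasure \<nu> (- {0..}) = 0" by (rule pole(1)[of "\<lambda>_. 0::real"]) simp
  \<comment> \<open>The density \<open>c / u\<^sup>2\<close> is chosen for this: in the Stieltjes
    kernel one factor \<open>u\<close> cancels, leaving the second partial fraction. At
    \<open>u = 0\<close> both sides are 0.\<close>
  have ident: "(c / (u t)\<^sup>2) *\<^sub>R (1 / (p + complex_of_real ((1 - u t) / u t))) =
      complex_of_real c / (complex_of_real (u t) * (p * complex_of_real (u t) + 1 - complex_of_real (u t)))" for p t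
  proof (cases "u t = 0")
    case False
    then have "p * complex_of_real (u t) + 1 - complex_of_real (u t) = complex_of_real (u t) * (p + complex_of_real ((1 - u t) / u t))"
      by (simp add: field_simps)
    then show ?thesis by (simp add: scaleR_conv_of_real power2_eq_square)
  qed simp
  have ident1: "(c / (u t)\<^sup>2) *\<^sub>R (1 / (1 + (1 - u t) / u t)) = c / u t" for t
    by (cases "u t = 0") (auto simp: power2_eq_square field_simps)
  have int: "set_integrable \<nu> {0..} (\<lambda>r. 1 / (1 + r))"
    by (subst pole(2)) (use rec(2) in \<open>simp_all only: ident1, simp_all\<close>)
  have S_rep: "S p = complex_of_real B + (LINT r:{0..}|\<nu>. 1 / (p + complex_of_real r))" if p: "p \<in> slit_plane" for p
  proof -
    have i1: "integrable P (\<lambda>t. complex_of_real (c / u t))"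
      using rec(2) by (intro integrable_of_real)
    have i2: "integrable P (\<lambda>t. complex_of_real c / (complex_of_real (u t) * (p * complex_of_real (u t) + 1 - complex_of_real (u t))))"
    proof -
      have "set_integrable \<nu> {0..} (\<lambda>r. 1 / (p + complex_of_real r))"
        by (rule stieltjes_kernel_integrable[OF sets _ _ int p]) auto
      then show ?thesis using pole(2)[of "\<lambda>r. 1 / (p + complex_of_real r)"] by (simp only: ident) simp
    qed
    have "complex_of_real c * (LINT t|P. (p - 1) / (p * complex_of_real (u t) + 1 - complex_of_real (u t))) =
      (LINT t|P. complex_of_real c * ((p - 1) / (p * complex_of_real (u t) + 1 - complex_of_real (u t))))"
      by (rule integral_mult_right_zero[symmetric])
    also have "\<dots> = (LINT t|P. complex_of_real (c / u t) -
        complex_of_real c / (complex_of_real (u t) * (p * complex_of_real (u t) + 1 - complex_of_real (u t))))"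
    proof (rule integral_cong_AE)
      show "AE t in P. complex_of_real c * ((p - 1) / (p * complex_of_real (u t) + 1 - complex_of_real (u t))) =
        complex_of_real (c / u t) -
        complex_of_real c / (complex_of_real (u t) * (p * complex_of_real (u t) + 1 - complex_of_real (u t)))"
        using rec(1)
      proof eventually_elim
        case (elim t)
        show ?case
        proof (cases "c = 0")
          case False
          then have "complex_of_real (u t) \<noteq> 0" using elim by simp
          moreover have "p * complex_of_real (u t) + 1 - complex_of_real (u t) \<noteq> 0"
            by (rule segment_ne_0[OF p u])
          moreover have "x * ((p - 1) / d) = x / v - x / (v * d)" if "v \<noteq> 0" "d \<noteq> 0" "d = p * v + 1 - v" for x v d
            using that(1,2) by (simp add: divide_simps) (simp add: that(3) algebra_simps)
          ultimately show ?thesis by simp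
        qed simp
      qed
    qed (simp_all add: u_def)
    also have "\<dots> = complex_of_real (LINT t|P. c / u t) - (LINT r:{0..}|\<nu>. 1 / (p + complex_of_real r))"
      by (subst Bochner_Integration.integral_diff[OF i1 i2], subst pole(3)) (simp_all only: ident integral_complex_of_real, simp_all)
    finally show ?thesis
      using rep[OF p] by (simp add: u_def[symmetric] S1 B_def)
  qed
  have "emeasure \<nu> {0} = 0"
  proof -
    have fin: "emeasure \<nu> {0} < \<infinity>"
    proof -
      have "{0..} \<inter> {..0} = {0::real}" by auto
      then show ?thesis using emeasure_bounded_part[OF sets _ _ int, of 0] by simp
    qed
    define m where "m = Sigma_Algebra.measure \<nu> {0}"
    \<comment> \<open>An atom of mass \<open>m\<close> at 0 contributes \<open>m / x\<close> to
      \<open>S x\<close>, which is at most \<open>C\<close>; letting \<open>x\<close> tend to 0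
      gives \<open>m = 0\<close>.\<close>
    have "m \<le> C * x" if x: "0 < x" for x
    proof -
      have K: "set_integrable \<nu> {0..} (\<lambda>r. 1 / (x + r))"
        by (rule stieltjes_kernel_integrable_real[OF sets _ _ int x]) auto
      have "(LINT r|\<nu>. indicator {0} r * (1 / x)) \<le> (LINT r:{0..}|\<nu>. 1 / (x + r))"
        unfolding set_lebesgue_integral_def
      proof (rule integral_mono)
        show "integrable \<nu> (\<lambda>r. indicator {0} r * (1 / x) :: real)"
          using fin by (intro integrable_mult_left integrable_real_indicator) (auto simp: sets)
        show "integrable \<nu> (\<lambda>r. indicator {0..} r *\<^sub>R (1 / (x + r)))"
          using K by (simp add: set_integrable_def)
        show "indicator {0} r * (1 / x) \<le> indicator {0..} r *\<^sub>R (1 / (x + r))" for r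
          using x by (auto simp: indicator_def)
      qed
      also have "(LINT r|\<nu>. indicator {0} r * (1 / x)) = m / x"
        using sets_eq_imp_space_eq[OF sets] by (simp add: m_def)
      also have "(LINT r:{0..}|\<nu>. 1 / (x + r)) = Re (LINT r:{0..}|\<nu>. complex_of_real (1 / (x + r)))"
        by (simp only: set_integral_complex_of_real Re_complex_of_real)
      also have "\<dots> \<le> Re (S (complex_of_real x))"
        using S_rep[OF slit_plane_of_real[OF x]] B by simp
      also have "\<dots> \<le> C" by (rule bdd[OF x])
      finally show ?thesis using x by (simp add: field_simps)
    qed
    then have "m \<le> 0"
      by (intro tendsto_lowerbound[of "\<lambda>x. C * x" 0 "at_right 0"])
         (auto intro!: tendsto_eq_intros eventually_at_right_less[THEN eventually_mono])
    then have "m = 0" by (simp add: m_def antisym)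
    then show ?thesis using fin by (auto simp: m_def measure_def enn2real_eq_0_iff)
  qed
  note atom = remove_atom[OF sets pole_neg this int]
  show ?thesis
    by (rule that[OF B atom(1,2)]) (simp add: S_rep atom(3))
qed

section \<open>Bernstein functions\<close>

lemma power_le_fact_exp: "0 \<le> y \<Longrightarrow> y ^ k \<le> fact k * exp (y::real)"
proof -
  assume y: "0 \<le> y"
  have "(\<Sum>n\<in>{k}. y ^ n /\<^sub>R fact n) \<le> (\<Sum>n. y ^ n /\<^sub>R fact n)"
    using y by (intro sum_le_suminf summable_exp_generic) auto
  then have "y ^ k / fact k \<le> exp y" by (simp add: exp_def divide_inverse mult.commute)
  then show ?thesis by (simp add: field_simps)
qed

text \<open>Multiplying by \<open>1 + r\<close> produces two consecutive powers, each bounded by a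
  single term of the exponential series.\<close>

lemma power_exp_bound:
  fixes r t :: real
  assumes r: "0 \<le> r" and t: "0 < t"
  shows "r ^ n * exp (- r * t) \<le> (fact n / t ^ n + fact (Suc n) / t ^ Suc n) * (1 / (1 + r))"
proof -
  have b: "r ^ k * exp (- r * t) \<le> fact k / t ^ k" for k
    using power_le_fact_exp[of "r * t" k] r t by (simp add: power_mult_distrib exp_minus field_simps)
  have "(1 + r) * (r ^ n * exp (- r * t)) = r ^ n * exp (- r * t) + r ^ Suc n * exp (- r * t)"
    by (simp add: algebra_simps)
  also have "\<dots> \<le> fact n / t ^ n + fact (Suc n) / t ^ Suc n"
    by (intro add_mono b)
  finally show ?thesis using r by (simp add: pos_le_divide_eq mult.commute)
qed

text \<open>Second-order Taylor expansion. The intermediate exponential is at most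
  \<open>exp (r * (t / 2))\<close>, so half of the decay of \<open>exp (- r * t)\<close> survives
  and keeps the remainder integrable in \<open>r\<close>.\<close>

lemma exp_remainder:
  fixes r s t :: real
  assumes r: "0 \<le> r" and t: "0 < t" "\<bar>s - t\<bar> \<le> t / 2"
  shows "\<bar>exp (- r * s) - exp (- r * t) - (s - t) * (- r * exp (- r * t))\<bar> \<le> (s - t)\<^sup>2 * (r\<^sup>2 * exp (- r * (t / 2)))"
proof -
  define y where "y = - r * (s - t)"
  obtain \<xi> where \<xi>: "\<bar>\<xi>\<bar> \<le> \<bar>y\<bar>" "exp y = (\<Sum>m<2. y ^ m / fact m) + exp \<xi> / fact 2 * y ^ 2"
    using Maclaurin_exp_le[of y 2] by blast
  have "\<bar>y\<bar> \<le> r * (t / 2)" unfolding y_def abs_mult using r t by (intro mult_mono) auto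
  then have \<xi>': "exp \<xi> \<le> exp (r * (t / 2))" using \<xi>(1) by simp
  have "exp (- r * s) = exp (- r * t) * exp y"
    by (simp add: y_def exp_add[symmetric] algebra_simps)
  then have "exp (- r * s) - exp (- r * t) - (s - t) * (- r * exp (- r * t)) = exp (- r * t) * (exp y - 1 - y)"
    by (simp add: y_def algebra_simps)
  also have "exp y - 1 - y = exp \<xi> / 2 * y\<^sup>2"
    using \<xi>(2) by (simp add: numeral_2_eq_2 fact_2)
  also have "\<bar>exp (- r * t) * (exp \<xi> / 2 * y\<^sup>2)\<bar> \<le> exp (- r * t) * (exp (r * (t / 2)) * y\<^sup>2)"
    using \<xi>' by (auto simp: abs_mult intro!: mult_mono)
  also have "\<dots> = (s - t)\<^sup>2 * (r\<^sup>2 * (exp (- r * t) * exp (r * (t / 2))))"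
    by (simp add: y_def power2_eq_square)
  also have "exp (- r * t) * exp (r * (t / 2)) = exp (- r * (t / 2))"
    by (simp add: exp_add[symmetric])
  finally show ?thesis .
qed

text \<open>A remainder quadratic in \<open>s - t\<close> integrates to an error of order
  \<open>\<bar>s - t\<bar>\<close> in the difference quotient.\<close>

lemma DERIV_set_integral:
  fixes f :: "real \<Rightarrow> real \<Rightarrow> real"
  assumes e: "0 < e"
    and f: "\<And>s. \<bar>s - t\<bar> < e \<Longrightarrow> set_integrable M A (f s)"
    and f': "set_integrable M A f'" and D: "set_integrable M A D"
    and bound: "\<And>s r. \<bar>s - t\<bar> < e \<Longrightarrow> r \<in> A \<Longrightarrow> \<bar>f s r - f t r - (s - t) * f' r\<bar> \<le> (s - t)\<^sup>2 * D r"
  shows "((\<lambda>s. LINT r:A|M. f s r) has_real_derivative (LINT r:A|M. f' r)) (at t)"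
proof -
  have est: "\<bar>((LINT r:A|M. f s r) - (LINT r:A|M. f t r)) / (s - t) - (LINT r:A|M. f' r)\<bar> \<le> \<bar>s - t\<bar> * (LINT r:A|M. D r)"
    if s: "\<bar>s - t\<bar> < e" "s \<noteq> t" for s
  proof -
    have ft: "set_integrable M A (f t)" using f[of t] e by simp
    note i = f[OF s(1)] ft f'
    have i1: "set_integrable M A (\<lambda>r. f s r - f t r)" by (rule set_integral_diff(1)[OF i(1,2)])
    have i2: "set_integrable M A (\<lambda>r. (s - t) * f' r)" using f' by simp
    have int: "set_integrable M A (\<lambda>r. f s r - f t r - (s - t) * f' r)"
      by (rule set_integral_diff(1)[OF i1 i2])
    have eq: "(LINT r:A|M. f s r) - (LINT r:A|M. f t r) - (s - t) * (LINT r:A|M. f' r) =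
        (LINT r:A|M. f s r - f t r - (s - t) * f' r)"
      using set_integral_diff(2)[OF i1 i2] set_integral_diff(2)[OF i(1,2)] by simp
    have "\<bar>LINT r:A|M. f s r - f t r - (s - t) * f' r\<bar> \<le> (LINT r:A|M. (s - t)\<^sup>2 * D r)"
    proof (rule order_trans[OF _ set_integral_mono])
      show "\<bar>LINT r:A|M. f s r - f t r - (s - t) * f' r\<bar> \<le> (LINT r:A|M. \<bar>f s r - f t r - (s - t) * f' r\<bar>)"
        using integral_abs_bound[of M "\<lambda>r. indicator A r *\<^sub>R (f s r - f t r - (s - t) * f' r)"]
        by (simp add: set_lebesgue_integral_def abs_mult)
      show "set_integrable M A (\<lambda>r. \<bar>f s r - f t r - (s - t) * f' r\<bar>)"
        by (rule set_integrable_abs[OF int])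
    qed (use D bound[OF s(1)] in auto)
    then have "\<bar>(LINT r:A|M. f s r) - (LINT r:A|M. f t r) - (s - t) * (LINT r:A|M. f' r)\<bar> \<le> (\<bar>s - t\<bar> * (LINT r:A|M. D r)) * \<bar>s - t\<bar>"
      unfolding eq by (simp add: power2_eq_square mult_ac)
    moreover have "((LINT r:A|M. f s r) - (LINT r:A|M. f t r)) / (s - t) - (LINT r:A|M. f' r) =
        ((LINT r:A|M. f s r) - (LINT r:A|M. f t r) - (s - t) * (LINT r:A|M. f' r)) / (s - t)"
      using s by (simp add: diff_divide_distrib)
    ultimately show ?thesis using s by (simp add: abs_divide pos_divide_le_eq)
  qed
  have "((\<lambda>s. ((LINT r:A|M. f s r) - (LINT r:A|M. f t r)) / (s - t)) \<longlongrightarrow> (LINT r:A|M. f' r)) (at t)"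
  proof (rule Lim_null[THEN iffD2], rule Lim_null_comparison)
    show "\<forall>\<^sub>F s in at t. norm (((LINT r:A|M. f s r) - (LINT r:A|M. f t r)) / (s - t) - (LINT r:A|M. f' r)) \<le> \<bar>s - t\<bar> * (LINT r:A|M. D r)"
      using e est by (auto simp: eventually_at dist_real_def)
    have "((\<lambda>s. \<bar>s - t\<bar> * (LINT r:A|M. D r)) \<longlongrightarrow> \<bar>t - t\<bar> * (LINT r:A|M. D r)) (at t)"
      by (intro tendsto_intros)
    then show "((\<lambda>s. \<bar>s - t\<bar> * (LINT r:A|M. D r)) \<longlongrightarrow> 0) (at t)" by simp
  qed
  then show ?thesis by (simp add: has_field_derivative_iff)
qed

lemma set_integrable_of_real:
  assumes "set_integrable M A f"
  shows "set_integrable M A (\<lambda>x. complex_of_real (f x))"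
proof -
  have "integrable M (\<lambda>x. complex_of_real (indicator A x *\<^sub>R f x))"
    using assms unfolding set_integrable_def by (rule integrable_of_real)
  then show ?thesis unfolding set_integrable_def by (simp add: scaleR_conv_of_real)
qed

context
  fixes \<nu> :: "real measure"
  assumes sets: "sets \<nu> = sets borel"
    and int: "set_integrable \<nu> {0<..} (\<lambda>r. 1 / (1 + r))"
begin

lemma power_exp_integrable: "0 < t \<Longrightarrow> set_integrable \<nu> {0<..} (\<lambda>r. r ^ n * exp (- r * t))"
proof (rule set_integral_bound(1)[OF sets _ int])
  fix r :: real assume "r \<in> {0<..}" "0 < t"
  then show "norm (r ^ n * exp (- r * t)) \<le> (fact n / t ^ n + fact (Suc n) / t ^ Suc n) * (1 / (1 + r))"
    using power_exp_bound[of r t n] by simp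
qed measurable

text \<open>The numerator is at most \<open>r * t\<close> and at most 1; the first bound serves near
  0 and the second at infinity.\<close>

lemma bernstein_kernel_integrable: "0 \<le> t \<Longrightarrow> set_integrable \<nu> {0<..} (\<lambda>r. (1 - exp (- r * t)) / r)"
proof (rule set_integral_bound(1)[OF sets _ int])
  fix r :: real assume r: "r \<in> {0<..}" and t: "0 \<le> t"
  define w where "w = 1 - exp (- r * t)"
  have w: "w \<le> r * t" "w \<le> 1" "0 \<le> w"
    using exp_ge_add_one_self[of "- r * t"] r t by (auto simp: w_def)
  have "w * r \<le> 1 * r" using w r by (intro mult_right_mono) auto
  then have 1: "w * (1 + r) \<le> (1 + t) * r"
    using w by (simp add: algebra_simps)
  have "norm (w / r) \<le> (1 + t) * (1 / (1 + r))"
    using r w 1 by (simp add: field_simps)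
  then show "norm ((1 - exp (- r * t)) / r) \<le> (1 + t) * (1 / (1 + r))"
    by (simp add: w_def)
qed measurable

lemma DERIV_power_exp:
  assumes t: "0 < t"
  shows "((\<lambda>s. LINT r:{0<..}|\<nu>. r ^ n * exp (- r * s)) has_real_derivative
    - (LINT r:{0<..}|\<nu>. r ^ Suc n * exp (- r * t))) (at t)"
proof -
  have "((\<lambda>s. LINT r:{0<..}|\<nu>. r ^ n * exp (- r * s)) has_real_derivative
    (LINT r:{0<..}|\<nu>. - (r ^ Suc n * exp (- r * t)))) (at t)"
  proof (rule DERIV_set_integral[where e="t / 2" and D="\<lambda>r. r ^ (n + 2) * exp (- r * (t / 2))"])
    show "set_integrable \<nu> {0<..} (\<lambda>r. - (r ^ Suc n * exp (- r * t)))"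
      using power_exp_integrable[OF t, of "Suc n"] unfolding set_integrable_def by simp
    show "set_integrable \<nu> {0<..} (\<lambda>r. r ^ (n + 2) * exp (- r * (t / 2)))"
      by (rule power_exp_integrable) (use t in simp)
    fix s r :: real assume s: "\<bar>s - t\<bar> < t / 2"
    show "set_integrable \<nu> {0<..} (\<lambda>r. r ^ n * exp (- r * s))"
      by (rule power_exp_integrable) (use s t in linarith)
    assume r: "r \<in> {0<..}"
    have "r ^ n * \<bar>exp (- r * s) - exp (- r * t) - (s - t) * (- r * exp (- r * t))\<bar> \<le>
        r ^ n * ((s - t)\<^sup>2 * (r\<^sup>2 * exp (- r * (t / 2))))"
      using r s t by (intro mult_left_mono exp_remainder) auto
    moreover have "r ^ n * \<bar>exp (- r * s) - exp (- r * t) - (s - t) * (- r * exp (- r * t))\<bar> =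
        \<bar>r ^ n * exp (- r * s) - r ^ n * exp (- r * t) - (s - t) * - (r ^ Suc n * exp (- r * t))\<bar>"
    proof -
      have "r ^ n * \<bar>X\<bar> = \<bar>r ^ n * X\<bar>" for X using r by (simp add: abs_mult)
      then show ?thesis by (simp only:) (simp add: algebra_simps)
    qed
    ultimately show "\<bar>r ^ n * exp (- r * s) - r ^ n * exp (- r * t) - (s - t) * - (r ^ Suc n * exp (- r * t))\<bar>
        \<le> (s - t)\<^sup>2 * (r ^ (n + 2) * exp (- r * (t / 2)))"
      by (simp add: power_add power2_eq_square mult_ac)
  qed (use t in simp)
  then show ?thesis by (simp add: set_lebesgue_integral_def)
qed

lemma DERIV_bernstein_kernel:
  assumes t: "0 < t"
  shows "((\<lambda>s. LINT r:{0<..}|\<nu>. (1 - exp (- r * s)) / r) has_real_derivative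
    (LINT r:{0<..}|\<nu>. exp (- r * t))) (at t)"
proof (rule DERIV_set_integral[where e="t / 2" and D="\<lambda>r. r ^ 1 * exp (- r * (t / 2))"])
  show "set_integrable \<nu> {0<..} (\<lambda>r. exp (- r * t))"
    using power_exp_integrable[OF t, of 0] by simp
  show "set_integrable \<nu> {0<..} (\<lambda>r. r ^ 1 * exp (- r * (t / 2)))"
    by (rule power_exp_integrable) (use t in simp)
  fix s r :: real assume s: "\<bar>s - t\<bar> < t / 2"
  show "set_integrable \<nu> {0<..} (\<lambda>r. (1 - exp (- r * s)) / r)"
    by (rule bernstein_kernel_integrable) (use s t in linarith)
  assume r: "r \<in> {0<..}"
  have "\<bar>exp (- r * s) - exp (- r * t) - (s - t) * (- r * exp (- r * t))\<bar> / r \<le>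
      ((s - t)\<^sup>2 * (r\<^sup>2 * exp (- r * (t / 2)))) / r"
    using r s t by (intro divide_right_mono exp_remainder) auto
  moreover have "\<bar>exp (- r * s) - exp (- r * t) - (s - t) * (- r * exp (- r * t))\<bar> / r =
      \<bar>(1 - exp (- r * s)) / r - (1 - exp (- r * t)) / r - (s - t) * exp (- r * t)\<bar>"
  proof -
    have "(1 - exp (- r * s)) / r - (1 - exp (- r * t)) / r - (s - t) * exp (- r * t) =
        - (exp (- r * s) - exp (- r * t) - (s - t) * (- r * exp (- r * t))) / r"
      using r by (simp add: field_simps)
    then show ?thesis using r by (simp only: abs_divide abs_minus) simp
  qed
  ultimately show "\<bar>(1 - exp (- r * s)) / r - (1 - exp (- r * t)) / r - (s - t) * exp (- r * t)\<bar>
      \<le> (s - t)\<^sup>2 * (r ^ 1 * exp (- r * (t / 2)))"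
    using r by (simp add: power2_eq_square)
qed (use t in simp)

text \<open>The derivative is the Laplace transform of \<open>\<nu>\<close>, and each further
  derivative puts a factor \<open>- r\<close> under the integral, which gives the alternating
  signs.\<close>

lemma bernstein_function_of_measure:
  assumes B: "0 \<le> B"
  shows "bernstein_function (\<lambda>t. B + (LINT r:{0<..}|\<nu>. (1 - exp (- r * t)) / r))"
    (is "bernstein_function ?g")
proof -
  define E where "E n t = (LINT r:{0<..}|\<nu>. r ^ n * exp (- r * t))" for n t
  have E: "0 \<le> E n t" for n t
    unfolding E_def set_lebesgue_integral_def by (intro integral_nonneg_AE AE_I2) (auto simp: indicator_def)
  have g: "(?g has_real_derivative E 0 t) (at t)" if "0 < t" for t
    using DERIV_add[OF DERIV_const DERIV_bernstein_kernel[OF that]] by (simp add: E_def)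
  have DE: "(E n has_real_derivative - E (Suc n) t) (at t)" if "0 < t" for n t
    unfolding E_def[abs_def] by (rule DERIV_power_exp[OF that])
  have *: "(deriv ^^ n) (deriv ?g) t = (-1) ^ n * E n t" if "0 < t" for n t
    using that
  proof (induction n arbitrary: t)
    case 0
    then show ?case using DERIV_imp_deriv[OF g] by simp
  next
    case (Suc n)
    \<comment> \<open>The formula for the \<open>n\<close>-th derivative is known only for positive
      arguments, so it is differentiated on that open set.\<close>
    have "((deriv ^^ n) (deriv ?g) has_real_derivative (-1) ^ n * - E (Suc n) t) (at t)"
      by (rule has_field_derivative_transform_within_open[OF DERIV_cmult[OF DE[OF Suc.prems]], of "{0<..}"])
         (use Suc in auto)
    then show ?case using DERIV_imp_deriv by fastforce
  qed
  have D: "(deriv ^^ n) (deriv ?g) differentiable (at t)" if t: "0 < t" for n t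
  proof -
    have "((deriv ^^ n) (deriv ?g) has_real_derivative (-1) ^ n * - E (Suc n) t) (at t)"
      by (rule has_field_derivative_transform_within_open[OF DERIV_cmult[OF DE[OF t]], of "{0<..}"])
         (use * t in auto)
    then show ?thesis by (auto simp: real_differentiable_def)
  qed
  show ?thesis
    unfolding bernstein_function_def completely_monotonic_def
  proof (intro conjI allI impI D)
    fix t :: real assume "0 \<le> t"
    then show "0 \<le> ?g t"
      using B unfolding set_lebesgue_integral_def
      by (intro add_nonneg_nonneg integral_nonneg_AE AE_I2) (auto simp: indicator_def)
  next
    fix t :: real assume "0 < t"
    then show "?g differentiable (at t)" using g by (auto simp: real_differentiable_def)
  next
    fix n and t :: real assume "0 < t"
    then show "0 \<le> (-1) ^ n * (deriv ^^ n) (deriv ?g) t"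
      unfolding *[OF \<open>0 < t\<close>] using E[of n t]
      by (simp add: mult.assoc[symmetric] power_mult_distrib[symmetric])
  qed
qed

text \<open>Each \<open>r\<close> contributes \<open>1 / (x * (x + r))\<close>; multiplication by
  \<open>x\<^sup>2\<close> therefore recovers \<open>B * x\<close> plus \<open>x\<close> times the
  Stieltjes transform.\<close>

lemma laplace_bernstein:
  assumes null: "emeasure \<nu> (- {0<..}) = 0" and x: "0 < x"
  shows "laplace (\<lambda>t. B + (LINT r:{0<..}|\<nu>. (1 - exp (- r * t)) / r)) (complex_of_real x) =
    complex_of_real (B / x + (LINT r:{0<..}|\<nu>. 1 / (x + r)) / x)"
proof -
  have A: "{0::real<..} \<in> sets borel" "{0<..} \<subseteq> {0::real..}" by auto
  \<comment> \<open>The product of \<open>(1 - exp (- r * t)) / r\<close> and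
    \<open>exp (- x * t)\<close>, written with two exponentials of known transform. Being
    nonnegative, it is its own norm in Fubini's theorem.\<close>
  define k where "k r t = (exp (- x * t) - exp (- (x + r) * t)) / r" for r t
  have e: "set_integrable lborel {0<..} (\<lambda>t. exp (- y * t))" "(LINT t:{0<..}|lborel. exp (- y * t)) = 1 / y"
    if "0 < y" for y :: real
    using exp_laplace(3,4)[of "complex_of_real y"] that by auto
  have k_int: "set_integrable lborel {0<..} (k r)" "(LINT t:{0<..}|lborel. k r t) = 1 / x * (1 / (x + r))" if r: "0 < r" for r
  proof -
    have xr: "0 < x + r" using x r by simp
    note d = set_integral_diff[OF e(1)[OF x] e(1)[OF xr]]
    show "set_integrable lborel {0<..} (k r)"
      unfolding k_def[abs_def] by (rule set_integrable_divide[OF d(1)])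
    have "(LINT t:{0<..}|lborel. k r t) = (1 / x - 1 / (x + r)) / r"
      unfolding k_def set_integral_divide_zero d(2) e(2)[OF x] e(2)[OF xr] ..
    moreover have "1 / x - 1 / (x + r) = r * (1 / x * (1 / (x + r)))"
      using x r by (simp add: field_simps)
    ultimately show "(LINT t:{0<..}|lborel. k r t) = 1 / x * (1 / (x + r))"
      using r by simp
  qed
  have k_nonneg: "0 \<le> k r t" if "0 < r" "0 < t" for r t
    using that by (auto simp: k_def algebra_simps)
  have sf: "sigma_finite_measure \<nu>"
  proof (rule sigma_finite_borelI[OF sets])
    fix n :: nat
    have "{..real n} \<subseteq> - {0<..} \<union> ({0<..} \<inter> {..real n})" by auto
    then have "emeasure \<nu> {..real n} \<le> emeasure \<nu> (- {0<..}) + emeasure \<nu> ({0<..} \<inter> {..real n})"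
      by (intro order_trans[OF emeasure_mono emeasure_subadditive]) (auto simp: sets)
    also have "\<dots> < \<infinity>" using emeasure_bounded_part[OF sets A int, of "real n"] null by simp
    finally show "emeasure \<nu> {..real n} < \<infinity>" .
  qed
  define K where "K r t = complex_of_real (k r t)" for r t
  have K_meas: "(\<lambda>(r, t). K r t) \<in> borel_measurable (borel \<Otimes>\<^sub>M borel)"
    unfolding K_def k_def by measurable
  have K_int: "set_integrable lborel {0<..} (K r)" if "r \<in> {0<..}" for r
    unfolding K_def[abs_def] by (rule set_integrable_of_real[OF k_int(1)]) (use that in simp)
  have K_norm: "(LINT t:{0<..}|lborel. norm (K r t)) = 1 / x * (1 / (x + r))" if "r \<in> {0<..}" for r
  proof -
    have "(LINT t:{0<..}|lborel. norm (K r t)) = (LINT t:{0<..}|lborel. k r t)"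
      using that k_nonneg by (intro set_lebesgue_integral_cong) (auto simp: K_def)
    then show ?thesis using k_int(2) that by simp
  qed
  have "set_integrable \<nu> {0<..} (\<lambda>r. 1 / x * (1 / (x + r)))"
    by (rule set_integrable_mult_right) (rule stieltjes_kernel_integrable_real[OF sets A int x])
  note fub = fubini_kernel[OF sf sets A(1) K_meas K_int K_norm this]
  have "laplace (\<lambda>t. B + (LINT r:{0<..}|\<nu>. (1 - exp (- r * t)) / r)) (complex_of_real x) =
      (LINT t:{0<..}|lborel. complex_of_real (B * exp (- x * t)) + (LINT r:{0<..}|\<nu>. K r t))"
    unfolding laplace_def
  proof (rule set_lebesgue_integral_cong, simp, intro allI impI)
    fix t :: real
    have "(LINT r:{0<..}|\<nu>. K r t) = complex_of_real (LINT r:{0<..}|\<nu>. k r t)"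
      unfolding K_def by (rule set_integral_complex_of_real)
    also have "(LINT r:{0<..}|\<nu>. k r t) = (LINT r:{0<..}|\<nu>. (1 - exp (- r * t)) / r * exp (- x * t))"
    proof -
      have "k r t = (1 - exp (- r * t)) / r * exp (- x * t)" for r
        by (simp add: k_def left_diff_distrib exp_add[symmetric] algebra_simps)
      then show ?thesis by simp
    qed
    also have "\<dots> = (LINT r:{0<..}|\<nu>. (1 - exp (- r * t)) / r) * exp (- x * t)"
      by (rule set_integral_mult_left)
    finally show "complex_of_real (B + (LINT r:{0<..}|\<nu>. (1 - exp (- r * t)) / r)) * exp (- complex_of_real x * complex_of_real t) =
        complex_of_real (B * exp (- x * t)) + (LINT r:{0<..}|\<nu>. K r t)"
      by (simp add: exp_of_real[symmetric] distrib_right)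
  qed
  also have "\<dots> = (LINT t:{0<..}|lborel. complex_of_real (B * exp (- x * t))) + (LINT t:{0<..}|lborel. (LINT r:{0<..}|\<nu>. K r t))"
  proof (rule set_integral_add(2)[OF _ fub(2)])
    show "set_integrable lborel {0<..} (\<lambda>t. complex_of_real (B * exp (- x * t)))"
      by (rule set_integrable_of_real) (use e(1)[OF x] in simp)
  qed
  also have "(LINT t:{0<..}|lborel. complex_of_real (B * exp (- x * t))) = complex_of_real (B / x)"
    unfolding set_integral_complex_of_real using e(2)[OF x] by simp
  also have "(LINT t:{0<..}|lborel. (LINT r:{0<..}|\<nu>. K r t)) = (LINT r:{0<..}|\<nu>. (LINT t:{0<..}|lborel. K r t))"
    by (rule fub(1))
  also have "\<dots> = (LINT r:{0<..}|\<nu>. complex_of_real (1 / x * (1 / (x + r))))"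
    by (intro set_lebesgue_integral_cong) (use sets k_int(2) in \<open>simp_all add: K_def set_integral_complex_of_real\<close>)
  also have "\<dots> = complex_of_real ((LINT r:{0<..}|\<nu>. 1 / (x + r)) / x)"
    unfolding set_integral_complex_of_real set_integral_mult_right by simp
  finally show ?thesis by (simp only: of_real_add)
qed

end

lemma complete_bernstein_of_measure:
  assumes radon: "radon_on {0<..} \<nu>" and int: "set_integrable \<nu> {0<..} (\<lambda>r. 1 / (1 + r))" and B: "0 \<le> B"
  shows "complete_bernstein (\<lambda>x. B * x + x * (LINT r:{0<..}|\<nu>. 1 / (x + r)))"
proof -
  have sets: "sets \<nu> = sets borel" and null: "emeasure \<nu> (- {0<..}) = 0"
    using radon by (auto simp: radon_on_def)
  show ?thesis
    unfolding complete_bernstein_def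
  proof (intro exI conjI allI impI)
    show "bernstein_function (\<lambda>t. B + (LINT r:{0<..}|\<nu>. (1 - exp (- r * t)) / r))"
      by (rule bernstein_function_of_measure[OF sets int B])
    fix x :: real assume x: "0 < x"
    define I where "I = (LINT r:{0<..}|\<nu>. 1 / (x + r))"
    have "B * x + x * I = x\<^sup>2 * (B / x + I / x)"
      using x by (simp add: power2_eq_square field_simps)
    then show "complex_of_real (B * x + x * (LINT r:{0<..}|\<nu>. 1 / (x + r))) = (complex_of_real x)\<^sup>2 *
        laplace (\<lambda>t. B + (LINT r:{0<..}|\<nu>. (1 - exp (- r * t)) / r)) (complex_of_real x)"
      unfolding laplace_bernstein[OF sets int null x] I_def[symmetric]
      by (simp only: of_real_mult of_real_power)
  qed
qed

section \<open>The relaxation modulus\<close>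

lemma Re_set_integral: "set_integrable M A f \<Longrightarrow> Re (LINT r:A|M. f r) = (LINT r:A|M. Re (f r))"
  unfolding set_lebesgue_integral_def set_integrable_def by (subst integral_Re[symmetric]) auto

lemma Im_set_integral: "set_integrable M A f \<Longrightarrow> Im (LINT r:A|M. f r) = (LINT r:A|M. Im (f r))"
  unfolding set_lebesgue_integral_def set_integrable_def by (subst integral_Im[symmetric]) auto

lemma cnj_set_integral: "cnj (LINT r:A|M. f r) = (LINT r:A|M. cnj (f r))"
  unfolding set_lebesgue_integral_def by (simp flip: Bochner_Integration.integral_cnj)

lemma set_integral_pos:
  fixes f :: "'a \<Rightarrow> real"
  assumes A: "A \<in> sets M" and f: "set_integrable M A f" "\<And>x. x \<in> A \<Longrightarrow> 0 < f x" and nz: "emeasure M A \<noteq> 0"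
  shows "0 < (LINT x:A|M. f x)"
proof -
  have n: "0 \<le> indicator A x *\<^sub>R f x" for x using f(2)[of x] by (auto simp: indicator_def)
  then have "0 \<le> (LINT x:A|M. f x)" unfolding set_lebesgue_integral_def by simp
  moreover have "(LINT x:A|M. f x) \<noteq> 0"
  proof
    assume "(LINT x:A|M. f x) = 0"
    then have "AE x in M. indicator A x *\<^sub>R f x = 0"
      using integral_nonneg_eq_0_iff_AE[of M "\<lambda>x. indicator A x *\<^sub>R f x"] n f(1)
      by (simp add: set_lebesgue_integral_def set_integrable_def)
    then have "AE x in M. x \<notin> A"
      by eventually_elim (use f(2) in \<open>force simp: indicator_def split: if_splits\<close>)
    then have "emeasure M A = 0"
      using A by (simp add: AE_iff_null_sets[symmetric] null_sets_def)
    then show False using nz by simp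
  qed
  ultimately show ?thesis by simp
qed

lemma connected_slit_plane: "connected slit_plane"
proof -
  have "slit_plane = - (complex_of_real ` {..0})"
    by (auto simp: slit_plane_iff complex_eq_iff)
  then show ?thesis
    using starlike_slotted_complex_plane_left[of 0] by (simp add: starlike_imp_connected)
qed

text \<open>To be instantiated with the measure chosen by \<open>bernstein_measure\<close> and with
  the limit of \<open>G\<close> as \<open>g\<close>.\<close>

locale bernstein_represented =
  fixes G :: "real \<Rightarrow> real" and \<mu> :: "real measure" and g :: real
  assumes rep: "represents \<mu> G" and int: "set_integrable \<mu> {0..} (\<lambda>r. 1 / (1 + r))"
    and g: "0 < g" "\<And>t. 0 < t \<Longrightarrow> g \<le> G t"
begin

definition Q :: "complex \<Rightarrow> complex" where
  "Q p = p * (LINT r:{0..}|\<mu>. 1 / (p + complex_of_real r))"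

lemma sets: "sets \<mu> = sets borel"
  using rep by (simp add: represents_def radon_on_def)

lemma rep_integral:
  assumes "0 < t"
  shows "set_integrable \<mu> {0..} (\<lambda>r. exp (- r * t))" "G t = (LINT r:{0..}|\<mu>. exp (- r * t))"
  using rep assms unfolding represents_def by blast+

lemma kernel_integrable: "p \<in> slit_plane \<Longrightarrow> set_integrable \<mu> {0..} (\<lambda>r. 1 / (p + complex_of_real r))"
  by (rule stieltjes_kernel_integrable[OF sets _ _ int]) auto

text \<open>A null measure would give \<open>G 1 = 0\<close>. Positive mass is what makes
  \<open>Im\<close> of the Stieltjes transform strictly negative in the upper half-plane.\<close>

lemma mass: "emeasure \<mu> {0..} \<noteq> 0"
proof
  assume "emeasure \<mu> {0..} = 0"
  then have "AE r in \<mu>. r \<notin> {0..}"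
    using sets by (intro AE_not_in null_setsI) auto
  then have "(LINT r:{0..}|\<mu>. exp (- r * 1)) = 0"
    unfolding set_lebesgue_integral_def
    by (intro integral_eq_zero_AE) (auto elim!: eventually_mono)
  then show False using rep g(1) g(2)[of 1] by (simp add: represents_def)
qed

lemma Q_holomorphic: "Q holomorphic_on slit_plane"
  unfolding Q_def[abs_def]
  by (intro holomorphic_intros stieltjes_holomorphic[OF sets _ _ int]) auto

lemma Q_cnj: "Q (cnj p) = cnj (Q p)"
  by (simp add: Q_def cnj_set_integral)

text \<open>The lower bound compares integrands:
  \<open>exp (- r / x) \<le> 1 / (1 + r / x) = x / (x + r)\<close>, so \<open>G (1 / x)\<close> lies
  below \<open>Q x\<close>.\<close>

lemma Q_real:
  assumes x: "0 < x"
  shows "Q (complex_of_real x) = complex_of_real (Re (Q (complex_of_real x)))" "g \<le> Re (Q (complex_of_real x))"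
proof -
  have "Q (complex_of_real x) = complex_of_real x * (LINT r:{0..}|\<mu>. complex_of_real (1 / (x + r)))"
    by (simp add: Q_def)
  also have "\<dots> = complex_of_real (x * (LINT r:{0..}|\<mu>. 1 / (x + r)))"
    by (simp only: set_integral_complex_of_real of_real_mult)
  finally have Q: "Q (complex_of_real x) = complex_of_real (x * (LINT r:{0..}|\<mu>. 1 / (x + r)))" .
  then show "Q (complex_of_real x) = complex_of_real (Re (Q (complex_of_real x)))" by simp
  have "g \<le> G (1 / x)" using g(2) x by simp
  also have "\<dots> = (LINT r:{0..}|\<mu>. exp (- r * (1 / x)))"
    by (rule rep_integral(2)) (use x in simp)
  also have "\<dots> \<le> (LINT r:{0..}|\<mu>. x * (1 / (x + r)))"
  proof (rule set_integral_mono)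
    show "set_integrable \<mu> {0..} (\<lambda>r. exp (- r * (1 / x)))"
      by (rule rep_integral(1)) (use x in simp)
    show "set_integrable \<mu> {0..} (\<lambda>r. x * (1 / (x + r)))"
      by (intro set_integrable_mult_right stieltjes_kernel_integrable_real[OF sets _ _ int x]) auto
    fix r :: real assume "r \<in> {0..}"
    then have "1 / exp (r / x) \<le> 1 / (1 + r / x)"
      using exp_ge_add_one_self[of "r / x"] x by (intro frac_le) (auto intro: add_pos_nonneg)
    also have "1 / (1 + r / x) = x * (1 / (x + r))"
      using x by (simp add: field_simps)
    finally show "exp (- r * (1 / x)) \<le> x * (1 / (x + r))"
      by (simp add: exp_minus field_simps)
  qed
  finally show "g \<le> Re (Q (complex_of_real x))"
    by (simp only: Q set_integral_mult_right Re_complex_of_real)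
qed

lemma Im_kernel: "Im (1 / (p + complex_of_real r)) = - Im p * (1 / (norm (p + complex_of_real r))\<^sup>2)"
  by (simp add: Im_divide cmod_power2)

text \<open>The imaginary part of \<open>p / (p + r)\<close> is \<open>r * Im p\<close> divided by
  the squared norm of \<open>p + r\<close>.\<close>

lemma Im_Q_nonneg:
  assumes p: "p \<in> slit_plane" and Im: "0 \<le> Im p"
  shows "0 \<le> Im (Q p)"
proof -
  have "Q p = (LINT r:{0..}|\<mu>. p * (1 / (p + complex_of_real r)))"
    unfolding Q_def by (rule set_integral_mult_right[symmetric])
  moreover have "set_integrable \<mu> {0..} (\<lambda>r. p * (1 / (p + complex_of_real r)))"
    by (intro set_integrable_mult_right kernel_integrable[OF p])
  ultimately have "Im (Q p) = (LINT r:{0..}|\<mu>. Im (p * (1 / (p + complex_of_real r))))"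
    by (simp only: Im_set_integral)
  also have "\<dots> \<ge> 0"
    unfolding set_lebesgue_integral_def
  proof (intro integral_nonneg_AE AE_I2)
    fix r
    show "0 \<le> indicator {0..} r *\<^sub>R Im (p * (1 / (p + complex_of_real r)))"
      using Im by (auto simp: indicator_def Im_divide algebra_simps)
  qed
  finally show ?thesis .
qed

text \<open>For \<open>Im p > 0\<close> the Stieltjes transform \<open>Q p / p\<close> has strictly
  negative imaginary part, whereas a real \<open>Q p \<le> 0\<close> would make it nonnegative.
  Conjugation handles the lower half-plane, and the bound by \<open>g\<close> the positive
  axis.\<close>

lemma Q_slit_plane:
  assumes p: "p \<in> slit_plane"
  shows "Q p \<in> slit_plane"
proof -
  have upper: "Q p \<in> slit_plane" if p: "0 < Im p" for p
  proof (rule ccontr)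
    define \<Phi> where "\<Phi> = (LINT r:{0..}|\<mu>. 1 / (p + complex_of_real r))"
    have ps: "p \<in> slit_plane" using p by (simp add: slit_plane_iff)
    note i = kernel_integrable[OF ps]
    have nz: "norm (p + complex_of_real r) \<noteq> 0" if "r \<in> {0..}" for r
      using slit_plane_add_ne_0[OF ps] that by simp
    have "Im (- \<Phi>) = (LINT r:{0..}|\<mu>. - Im (1 / (p + complex_of_real r)))"
      unfolding \<Phi>_def using Im_set_integral[OF i] by (simp add: set_lebesgue_integral_def)
    also have "\<dots> > 0"
    proof (rule set_integral_pos)
      show "set_integrable \<mu> {0..} (\<lambda>r. - Im (1 / (p + complex_of_real r)))"
        using i unfolding set_integrable_def by (auto dest: integrable_Im)
      show "0 < - Im (1 / (p + complex_of_real r))" if "r \<in> {0..}" for r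
        unfolding Im_kernel using p nz[OF that] by simp
    qed (use sets mass in auto)
    finally have neg: "Im \<Phi> < 0" by simp
    assume "Q p \<notin> slit_plane"
    then have Q: "Im (Q p) = 0" "Re (Q p) \<le> 0" by (auto simp: slit_plane_iff)
    have "\<Phi> = Q p / p" using p by (auto simp: Q_def \<Phi>_def)
    then have "Im \<Phi> = - Re (Q p) * Im p / (norm p)\<^sup>2"
      using Q by (simp add: Im_divide cmod_power2)
    also have "\<dots> \<ge> 0" using Q p by (intro divide_nonneg_nonneg mult_nonneg_nonneg) auto
    finally show False using neg by simp
  qed
  consider "0 < Im p" | "Im p < 0" | "Im p = 0" "0 < Re p" using p by (force simp: slit_plane_iff)
  then show ?thesis
  proof cases
    case 2
    then have "Q (cnj p) \<in> slit_plane" by (intro upper) simp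
    then show ?thesis by (simp add: Q_cnj slit_plane_iff)
  next
    case 3
    then have "p = complex_of_real (Re p)" by (simp add: complex_eq_iff)
    moreover have "0 < Re (Q (complex_of_real (Re p)))"
      using Q_real(2)[OF 3(2)] g by linarith
    ultimately show ?thesis using slit_plane_Re_pos by metis
  qed (rule upper)
qed

section \<open>The square root of \<open>Q\<close> and the function kappa\<close>

definition rootQ :: "complex \<Rightarrow> complex" where "rootQ p = csqrt (Q p)"

lemma rootQ_squared: "(rootQ p)\<^sup>2 = Q p"
  by (simp add: rootQ_def)

lemma rootQ_Re: "p \<in> slit_plane \<Longrightarrow> 0 < Re (rootQ p)"
  unfolding rootQ_def by (rule slit_plane_csqrt_Re[OF Q_slit_plane])

lemma rootQ_real:
  assumes x: "0 < x"
  shows "rootQ (complex_of_real x) = complex_of_real (sqrt (Re (Q (complex_of_real x))))"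
proof -
  have "Im (Q (complex_of_real x)) = 0"
    by (subst Q_real(1)[OF x]) simp
  moreover have "0 \<le> Re (Q (complex_of_real x))" using Q_real(2)[OF x] g by linarith
  ultimately show ?thesis unfolding rootQ_def by (rule csqrt_of_real_nonneg)
qed

lemma rootQ_holomorphic: "rootQ holomorphic_on slit_plane"
proof -
  have "(csqrt \<circ> Q) holomorphic_on slit_plane"
    by (rule holomorphic_on_compose_gen[OF Q_holomorphic holomorphic_on_csqrt])
       (use Q_slit_plane in \<open>auto simp: slit_plane_def\<close>)
  then show ?thesis by (simp add: rootQ_def[abs_def] comp_def)
qed

lemma rootQ_cnj:
  assumes "p \<in> slit_plane"
  shows "rootQ (cnj p) = cnj (rootQ p)"
proof -
  have "rootQ (cnj p) = csqrt ((cnj (rootQ p))\<^sup>2)"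
    unfolding rootQ_def Q_cnj by (simp flip: complex_cnj_power)
  also have "\<dots> = cnj (rootQ p)" using rootQ_Re[OF assms] by (intro csqrt_square) simp
  finally show ?thesis .
qed

lemma Im_rootQ_nonneg:
  assumes "p \<in> slit_plane" "0 \<le> Im p"
  shows "0 \<le> Im (rootQ p)"
proof -
  have "Im (Q p) = 2 * Re (rootQ p) * Im (rootQ p)"
    using rootQ_squared[of p] by (metis Im_power2)
  then show ?thesis using Im_Q_nonneg[OF assms] rootQ_Re[OF assms(1)] by (simp add: zero_le_mult_iff)
qed

text \<open>The quotient of the two roots is continuous with values 1 and -1 on a connected set,
  hence constant; positivity of both real parts at 1 excludes -1.\<close>

lemma sqrt_branch_unique:
  assumes S: "is_sqrt_branch Q S" and p: "p \<in> slit_plane"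
  shows "S p = rootQ p"
proof -
  have nz: "rootQ p \<noteq> 0" if "p \<in> slit_plane" for p using rootQ_Re[OF that] by auto
  define h where "h p = S p / rootQ p" for p
  have cont: "continuous_on slit_plane h"
    unfolding h_def[abs_def] using S nz rootQ_holomorphic
    by (intro continuous_on_divide holomorphic_on_imp_continuous_on) (auto simp: is_sqrt_branch_def)
  have sign: "h p \<in> {1, -1}" if "p \<in> slit_plane" for p
  proof -
    have "(h p)\<^sup>2 = 1"
      using S that nz[OF that] rootQ_squared[of p] by (auto simp: is_sqrt_branch_def h_def power_divide)
    then show ?thesis by (simp add: power2_eq_1_iff)
  qed
  then have "h ` slit_plane \<subseteq> {1, -1}" by blast
  then have "finite (h ` slit_plane)" by (rule finite_subset) simp
  moreover have "connected slit_plane" by (rule connected_slit_plane)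
  ultimately have "h constant_on slit_plane"
    using cont continuous_finite_range_constant by blast
  moreover have one: "1 \<in> slit_plane" using slit_plane_of_real[of 1] by simp
  ultimately have "h p = h 1" using p by (metis constant_on_def)
  also have "h 1 = 1"
  proof -
    have S1: "S 1 \<in> \<real>" "0 < Re (S 1)" using S by (auto simp: is_sqrt_branch_def dest!: spec[of _ 1])
    have T1: "0 < Re (rootQ 1)" by (rule rootQ_Re[OF one])
    have "h 1 \<in> {1, -1}" by (rule sign[OF one])
    moreover have "h 1 \<noteq> -1"
    proof
      assume "h 1 = -1"
      then have "S 1 = - rootQ 1" using nz[OF one] by (simp add: h_def divide_eq_eq)
      then show False using S1 T1 by simp
    qed
    ultimately show ?thesis by simp
  qed
  finally show ?thesis using nz[OF p] by (simp add: h_def)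
qed

lemma sqrt_branch_eq: "p \<in> slit_plane \<Longrightarrow> sqrt_branch Q p = rootQ p"
proof (rule sqrt_branch_unique)
  have "0 < Re (Q (complex_of_real x))" if "0 < x" for x
    using Q_real(2)[OF that] g by linarith
  then have "is_sqrt_branch Q rootQ"
    unfolding is_sqrt_branch_def using rootQ_holomorphic rootQ_squared rootQ_real rootQ_Re slit_plane_of_real by auto
  then show "is_sqrt_branch Q (sqrt_branch Q)"
    unfolding sqrt_branch_def by (rule someI[of "is_sqrt_branch Q"])
qed

text \<open>The Stieltjes representation is applied to kappa divided by \<open>p\<close>; the lower
  bound \<open>g\<close> of \<open>Q\<close> on the positive axis becomes the upper bound
  \<open>sqrt \<rho> / sqrt g\<close>.\<close>

lemma kappa_representation:
  assumes \<rho>: "0 < \<rho>"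
  obtains B \<nu> where "0 \<le> B" "radon_on {0<..} \<nu>" "set_integrable \<nu> {0<..} (\<lambda>r. 1 / (1 + r))"
    "\<And>p. p \<in> slit_plane \<Longrightarrow> complex_of_real (sqrt \<rho>) * p / rootQ p = complex_of_real B * p + beta_fun \<nu> p"
proof -
  define S where "S p = complex_of_real (sqrt \<rho>) / rootQ p" for p
  have nz: "rootQ p \<noteq> 0" if "p \<in> slit_plane" for p using rootQ_Re[OF that] by auto
  have hol: "S holomorphic_on slit_plane"
    unfolding S_def[abs_def] using nz by (intro holomorphic_intros rootQ_holomorphic) auto
  have sym: "S (cnj p) = cnj (S p)" if "p \<in> slit_plane" for p
    using rootQ_cnj[OF that] by (simp add: S_def)
  have neg: "Im (S p) \<le> 0" if "p \<in> slit_plane" "0 \<le> Im p" for p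
  proof -
    have "Im (S p) = - (sqrt \<rho> * Im (rootQ p) / (norm (rootQ p))\<^sup>2)"
      by (simp add: S_def Im_divide cmod_power2)
    then show ?thesis using Im_rootQ_nonneg[OF that] \<rho> by simp
  qed
  have S_real: "S (complex_of_real x) = complex_of_real (sqrt \<rho> / sqrt (Re (Q (complex_of_real x))))" if "0 < x" for x
    by (simp add: S_def rootQ_real[OF that])
  have pos: "0 \<le> Re (S (complex_of_real x))" if "0 < x" for x
    using \<rho> Q_real(2)[OF that] g by (simp add: S_real[OF that])
  have bdd: "Re (S (complex_of_real x)) \<le> sqrt \<rho> / sqrt g" if "0 < x" for x
    using \<rho> Q_real(2)[OF that] g by (simp add: S_real[OF that] frac_le)
  obtain B \<nu> where B: "0 \<le> B" "radon_on {0<..} \<nu>" "set_integrable \<nu> {0<..} (\<lambda>r. 1 / (1 + r))"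
    and S: "\<And>p. p \<in> slit_plane \<Longrightarrow> S p = complex_of_real B + (LINT r:{0<..}|\<nu>. 1 / (p + complex_of_real r))"
    using stieltjes_representation[OF hol sym neg pos bdd] by blast
  have "complex_of_real (sqrt \<rho>) * p / rootQ p = complex_of_real B * p + beta_fun \<nu> p" if "p \<in> slit_plane" for p
  proof -
    have "complex_of_real (sqrt \<rho>) * p / rootQ p = S p * p" by (simp add: S_def)
    then show ?thesis unfolding S[OF that] beta_fun_def by (simp add: algebra_simps)
  qed
  with B show ?thesis by (rule that)
qed

end

text \<open>At \<open>p = - \<i> * \<omega>\<close> the kernel is
  \<open>(r + \<i> * \<omega>) / (\<omega>\<^sup>2 + r\<^sup>2)\<close>; the factor \<open>p\<close>
  interchanges real and imaginary parts.\<close>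

lemma beta_fun_imaginary:
  assumes sets: "sets \<nu> = sets borel" and int: "set_integrable \<nu> {0<..} (\<lambda>r. 1 / (1 + r))" and \<omega>: "\<omega> \<noteq> 0"
  shows "Re (beta_fun \<nu> (- \<i> * complex_of_real \<omega>)) = \<omega>\<^sup>2 * (LINT r:{0<..}|\<nu>. 1 / (\<omega>\<^sup>2 + r\<^sup>2))"
    and "Im (beta_fun \<nu> (- \<i> * complex_of_real \<omega>)) = - (\<omega> * (LINT r:{0<..}|\<nu>. r / (\<omega>\<^sup>2 + r\<^sup>2)))"
proof -
  define p where "p = - \<i> * complex_of_real \<omega>"
  define \<Phi> where "\<Phi> = (LINT r:{0<..}|\<nu>. 1 / (p + complex_of_real r))"
  have "p \<in> slit_plane" using \<omega> by (simp add: p_def slit_plane_iff)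
  then have i: "set_integrable \<nu> {0<..} (\<lambda>r. 1 / (p + complex_of_real r))"
    by (intro stieltjes_kernel_integrable[OF sets _ _ int]) auto
  have "Re (1 / (p + complex_of_real r)) = r / (\<omega>\<^sup>2 + r\<^sup>2)" "Im (1 / (p + complex_of_real r)) = \<omega> * (1 / (\<omega>\<^sup>2 + r\<^sup>2))" for r
    by (simp_all add: p_def Re_divide Im_divide add.commute)
  then have \<Phi>: "Re \<Phi> = (LINT r:{0<..}|\<nu>. r / (\<omega>\<^sup>2 + r\<^sup>2))" "Im \<Phi> = \<omega> * (LINT r:{0<..}|\<nu>. 1 / (\<omega>\<^sup>2 + r\<^sup>2))"
    unfolding \<Phi>_def Re_set_integral[OF i] Im_set_integral[OF i] by (simp_all only: set_integral_mult_right)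
  have b: "beta_fun \<nu> p = p * \<Phi>" by (simp add: beta_fun_def \<Phi>_def)
  show "Re (beta_fun \<nu> (- \<i> * complex_of_real \<omega>)) = \<omega>\<^sup>2 * (LINT r:{0<..}|\<nu>. 1 / (\<omega>\<^sup>2 + r\<^sup>2))"
    unfolding p_def[symmetric] b by (simp add: p_def \<Phi> power2_eq_square)
  show "Im (beta_fun \<nu> (- \<i> * complex_of_real \<omega>)) = - (\<omega> * (LINT r:{0<..}|\<nu>. r / (\<omega>\<^sup>2 + r\<^sup>2)))"
    unfolding p_def[symmetric] b by (simp add: p_def \<Phi>)
qed

theorem mainTheorem1:
  fixes \<rho> G_inf :: real and G :: "real \<Rightarrow> real"
  assumes "0 < \<rho>"
    and "locally_integrable_cm G"
    and "(G \<longlongrightarrow> G_inf) at_top"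
    and "0 < G_inf"
  shows "(\<forall>p. 0 < Re p \<longrightarrow> Q_mod G p = p * laplace G p) \<and>
    complete_bernstein_slit (kappa \<rho> G) \<and>
    (\<exists>(B::real) \<nu>. 0 \<le> B \<and> radon_on {0<..} \<nu> \<and> set_integrable \<nu> {0<..} (\<lambda>r. 1 / (1 + r)) \<and>
       (\<forall>p\<in>slit_plane. kappa \<rho> G p = complex_of_real B * p + beta_fun \<nu> p) \<and>
       (\<forall>\<omega>. \<omega> \<noteq> 0 \<longrightarrow>
          attenuation \<nu> \<omega> = Re (kappa \<rho> G (- \<i> * complex_of_real \<omega>)) \<and>
          attenuation \<nu> \<omega> = \<omega>\<^sup>2 * (LINT r:{0<..}|\<nu>. 1 / (\<omega>\<^sup>2 + r\<^sup>2)) \<and>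
          dispersion \<nu> \<omega> = \<omega> * (LINT r:{0<..}|\<nu>. r / (\<omega>\<^sup>2 + r\<^sup>2))))"
proof -
  have cm: "completely_monotonic G" and loc: "set_integrable lborel {0..1} G"
    using assms(2) by (auto simp: locally_integrable_cm_def)
  \<comment> \<open>\<open>G\<close> is decreasing, so its limit bounds it from below.\<close>
  have ge: "G_inf \<le> G t" if "0 < t" for t
  proof (rule tendsto_upperbound[OF assms(3)])
    show "\<forall>\<^sub>F s in at_top. G s \<le> G t"
      using eventually_ge_at_top[of t] by eventually_elim (rule completely_monotonic_antimono[OF cm that])
  qed simp
  obtain \<mu>0 where "represents \<mu>0 G"
    using bernstein_representation[OF cm] ge assms(4) by (meson less_le_trans)
  then have rep: "represents (bernstein_measure G) G"
    unfolding bernstein_measure_def by (rule someI)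
  note int = represents_stieltjes_integrable[OF rep loc]
  interpret bernstein_represented G "bernstein_measure G" G_inf
    by unfold_locales (use rep int assms(4) ge in auto)
  have Q: "Q_mod G = Q" by (rule ext) (simp add: Q_mod_def Q_def)
  have kappa: "kappa \<rho> G p = complex_of_real (sqrt \<rho>) * p / rootQ p" if "p \<in> slit_plane" for p
    by (simp add: kappa_def Q sqrt_branch_eq[OF that])
  obtain B \<nu> where B: "0 \<le> B" and radon: "radon_on {0<..} \<nu>"
    and \<nu>: "set_integrable \<nu> {0<..} (\<lambda>r. 1 / (1 + r))"
    and k: "\<And>p. p \<in> slit_plane \<Longrightarrow> kappa \<rho> G p = complex_of_real B * p + beta_fun \<nu> p"
    using kappa_representation[OF assms(1)] kappa by metis
  have sets_\<nu>: "sets \<nu> = sets borel" using radon by (simp add: radon_on_def)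
  have "complete_bernstein_slit (kappa \<rho> G)"
    unfolding complete_bernstein_slit_def
  proof (intro conjI exI allI impI)
    have "(\<lambda>p. complex_of_real B * p + beta_fun \<nu> p) holomorphic_on slit_plane"
      unfolding beta_fun_def by (intro holomorphic_intros stieltjes_holomorphic[OF sets_\<nu> _ _ \<nu>]) auto
    then show "kappa \<rho> G holomorphic_on slit_plane"
      using k by (simp cong: holomorphic_cong)
    show "complete_bernstein (\<lambda>x. B * x + x * (LINT r:{0<..}|\<nu>. 1 / (x + r)))"
      by (rule complete_bernstein_of_measure[OF radon \<nu> B])
    fix x :: real assume x: "0 < x"
    have "(LINT r:{0<..}|\<nu>. 1 / (complex_of_real x + complex_of_real r)) =
        (LINT r:{0<..}|\<nu>. complex_of_real (1 / (x + r)))" by simp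
    then show "kappa \<rho> G (complex_of_real x) = complex_of_real (B * x + x * (LINT r:{0<..}|\<nu>. 1 / (x + r)))"
      unfolding k[OF slit_plane_of_real[OF x]] beta_fun_def
      by (simp only: set_integral_complex_of_real of_real_add of_real_mult)
  qed
  moreover have "Q_mod G p = p * laplace G p" if "0 < Re p" for p
    unfolding Q Q_def laplace_represents[OF rep int that] ..
  moreover have "attenuation \<nu> \<omega> = Re (kappa \<rho> G (- \<i> * complex_of_real \<omega>)) \<and>
          attenuation \<nu> \<omega> = \<omega>\<^sup>2 * (LINT r:{0<..}|\<nu>. 1 / (\<omega>\<^sup>2 + r\<^sup>2)) \<and>
          dispersion \<nu> \<omega> = \<omega> * (LINT r:{0<..}|\<nu>. r / (\<omega>\<^sup>2 + r\<^sup>2))" if \<omega>: "\<omega> \<noteq> 0" for \<omega>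
  proof -
    have "- \<i> * complex_of_real \<omega> \<in> slit_plane" using \<omega> by (simp add: slit_plane_iff)
    \<comment> \<open>The term \<open>B * p\<close> is purely imaginary at this point, so kappa and
      \<open>beta_fun\<close> have the same real part.\<close>
    from k[OF this] show ?thesis
      using beta_fun_imaginary[OF sets_\<nu> \<nu> \<omega>] by (simp add: attenuation_def dispersion_def)
  qed
  ultimately show ?thesis using B radon \<nu> k by blast
qed

end
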